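(* Let $r$ be either a positive integer or $r=\infty$. Every weakly $\mathscr{C}^r$ triangulable set $Y\subset\mathbb{R}^n$ is a $\mathscr{C}^r$-approximation target space.
   Context: All subsets of Euclidean spaces carry the relative Euclidean topology; $\mathbb{R}^+:=\{t\in\mathbb{R}: t>0\}$. The realization of a locally finite simplicial complex $L$ of $\mathbb{R}^q$ (each point of $|L|$ has a neighborhood in $|L|$ meeting only finitely many simplices) is denoted $|L|\subset\mathbb{R}^q$; such sets $|L|$ are called locally compact polyhedra. A non-empty set $Y\subset\mathbb{R}^n$ is triangulable if it is homeomorphic to a locally compact polyhedron of some $\mathbb{R}^q$. $\mathscr{C}^r$ maps: for $X\subset\mathbb{R}^m$ locally compact and $Y\subset\mathbb{R}^n$, a map $g:X\to Y$ is a $\mathscr{C}^r$ map if there exist an open neighborhood $U\subset\mathbb{R}^m$ of $X$ (in which $X$ is closed) and a map $G:U\to\mathbb{R}^n$ of class $\mathscr{C}^r$ in the standard sense such that $g(x)=G(x)$ for each $x\in X$. $\mathscr{C}^0(X,Y)$ is the set of continuous maps from $X$ to $Y$ and $\mathscr{C}^r(X,Y)$ the subset of $\mathscr{C}^r$ maps. Strong (Whitney) $\mathscr{C}^0$ topology on $\mathscr{C}^0(X,Y)$: a fundamental system of neighborhoods of $f$ is given by the sets $\{g\in\mathscr{C}^0(X,Y): \|g(x)-f(x)\|_n<\varepsilon(x)\ \forall x\in X\}$, where $\|\cdot\|_n$ is the Euclidean norm of $\mathbb{R}^n$ and $\varepsilon:X\to\mathbb{R}^+$ is a strictly positive continuous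 function. A triangulable set $Y\subset\mathbb{R}^n$ is a $\mathscr{C}^r$-approximation target space if $\mathscr{C}^r(X,Y)$ is dense in $\mathscr{C}^0(X,Y)$ (strong $\mathscr{C}^0$ topology) for each locally compact subset $X$ of each Euclidean space $\mathbb{R}^m$, $m\in\mathbb{N}$. A set $Y\subset\mathbb{R}^n$ is weakly $\mathscr{C}^r$ triangulable if there exist a locally finite simplicial complex $L$ of some $\mathbb{R}^q$ and a homeomorphism $\Psi:|L|\to Y$ such that the restriction $\Psi|_\xi:\xi\to Y$ is a $\mathscr{C}^r$ map for each simplex $\xi\in L$. *)

theory Defs
  imports
    "HOL-Analysis.Analysis"
    "HOL-Analysis.Finite_Function_Topology"
    "HOL-Library.Extended_Nat"
begin

section \<open>Euclidean spaces of arbitrary dimension\<close>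

text \<open>
  Dimensions are quantified inside the definitions below, so they cannot be types.  The space
  \<open>\<real>\<^sup>n\<close> is the set of finitely supported sequences that vanish from index \<open>n\<close> on.
  The library norm on this type is the \<open>l\<^sup>1\<close> norm.  On each \<open>Rn n\<close> it is equivalent to the
  Euclidean norm \<open>enorm\<close>, so continuity, openness, compactness and derivatives have
  their usual meaning there (see \<open>enorm_equivalent\<close> and \<open>homeomorphic_map_Rn_Euclidean_space\<close>).  The type class norm itself does not
  occur in the definitions; norm estimates use \<open>enorm\<close>.
\<close>

type_synonym fvec = "nat \<Rightarrow>\<^sub>0 real"

definition Rn :: "nat \<Rightarrow> fvec set" where
  "Rn n = {x. Poly_Mapping.keys x \<subseteq> {..<n}}"

definition enorm :: "fvec \<Rightarrow> real" where
  "enorm x = L2_set (Poly_Mapping.lookup x) (Poly_Mapping.keys x)"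

lemma norm_fvec: "norm (x::fvec) = (\<Sum>i\<in>Poly_Mapping.keys x. \<bar>Poly_Mapping.lookup x i\<bar>)"
  by (simp add: norm_poly_mapping_def dist_poly_mapping_def)

lemma enorm_equivalent:
  assumes "x \<in> Rn n"
  shows "enorm x \<le> norm x" "norm x \<le> sqrt (real n) * enorm x"
proof -
  let ?K = "Poly_Mapping.keys x"
  show "enorm x \<le> norm x"
    unfolding enorm_def norm_fvec by (rule L2_set_le_sum_abs)
  have "card ?K \<le> n"
    using assms card_mono[of "{..<n}" ?K] by (simp add: Rn_def)
  then have c: "sqrt (real (card ?K)) \<le> sqrt (real n)"
    by simp
  have "norm x = (\<Sum>i\<in>?K. \<bar>1\<bar> * \<bar>Poly_Mapping.lookup x i\<bar>)"
    by (simp add: norm_fvec)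
  also have "\<dots> \<le> L2_set (\<lambda>_. 1) ?K * L2_set (Poly_Mapping.lookup x) ?K"
    by (rule L2_set_mult_ineq)
  also have "\<dots> = sqrt (real (card ?K)) * enorm x"
    by (simp add: enorm_def L2_set_def)
  also have "\<dots> \<le> sqrt (real n) * enorm x"
    using c by (intro mult_right_mono) (auto simp: enorm_def)
  finally show "norm x \<le> sqrt (real n) * enorm x" .
qed

lemma continuous_on_lookup: "continuous_on S (\<lambda>x::fvec. Poly_Mapping.lookup x i)"
proof -
  have "dist (Poly_Mapping.lookup x i) (Poly_Mapping.lookup y i) \<le> dist x y" for x y :: fvec
  proof -
    let ?K = "Poly_Mapping.keys x \<union> Poly_Mapping.keys y"
    show ?thesis
    proof (cases "i \<in> ?K")
      case True
      then show ?thesis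
        unfolding dist_poly_mapping_def
        by (intro member_le_sum) auto
    next
      case False
      then show ?thesis by (simp add: in_keys_iff)
    qed
  qed
  then show ?thesis
    unfolding continuous_on_iff by (meson le_less_trans)
qed

lemma homeomorphic_map_Rn_Euclidean_space:
  "homeomorphic_map (top_of_set (Rn n)) (Euclidean_space n) Poly_Mapping.lookup"
proof -
  define inv where "inv f = (\<Sum>i<n. Poly_Mapping.single i (f i))" for f :: "nat \<Rightarrow> real"
  have lookup_inv: "Poly_Mapping.lookup (inv f) j = (if j < n then f j else 0)" for f j
    by (simp add: inv_def lookup_sum lookup_single when_def)
  have inv_Rn: "inv f \<in> Rn n" for f
    by (auto simp: Rn_def in_keys_iff lookup_inv split: if_splits)
  have lip: "continuous_on UNIV (\<lambda>t::real. Poly_Mapping.single i t)" for i :: nat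
  proof -
    have "dist (Poly_Mapping.single i s) (Poly_Mapping.single i t) \<le> dist s t" for s t :: real
      by (auto simp: dist_norm norm_fvec simp flip: single_diff)
    then show ?thesis
      unfolding continuous_on_iff by (meson le_less_trans)
  qed
  have "continuous_on UNIV inv"
    unfolding inv_def
    by (intro continuous_on_sum continuous_on_compose2[OF lip] continuous_on_product_coordinates) auto
  then have ci: "continuous_map (Euclidean_space n) (top_of_set (Rn n)) inv"
    unfolding Euclidean_space_def euclidean_product_topology
    by (auto simp: continuous_map_in_subtopology inv_Rn elim: continuous_on_subset)
  have "continuous_map (top_of_set (Rn n)) euclidean (Poly_Mapping.lookup :: fvec \<Rightarrow> _)"
    by (simp add: continuous_on_coordinatewise_then_product continuous_on_lookup)
  then have cl: "continuous_map (top_of_set (Rn n)) (Euclidean_space n) Poly_Mapping.lookup"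
    unfolding Euclidean_space_def
    by (auto simp: continuous_map_in_subtopology euclidean_product_topology Rn_def in_keys_iff)
  have "inv (Poly_Mapping.lookup x) = x" if "x \<in> Rn n" for x
    using that by (intro poly_mapping_eqI) (auto simp: lookup_inv Rn_def in_keys_iff)
  moreover have "Poly_Mapping.lookup (inv f) = f" if "f \<in> topspace (Euclidean_space n)" for f
    using that by (auto simp: lookup_inv topspace_Euclidean_space)
  ultimately have "homeomorphic_maps (top_of_set (Rn n)) (Euclidean_space n) Poly_Mapping.lookup inv"
    unfolding homeomorphic_maps_def using ci cl by auto
  then show ?thesis
    by (rule homeomorphic_maps_imp_map)
qed


section \<open>Maps of class \<open>C\<^sup>r\<close>\<close>

text \<open>
  For \<open>U\<close> open in \<open>Rn m\<close>, \<open>Ck_on m k U G\<close> says that all iterated partial derivatives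
  of \<open>G\<close> of order at most \<open>k\<close> exist and are continuous on \<open>U\<close>; \<open>D\<close> is the partial
  derivative in the direction of the \<open>i\<close>-th coordinate.
\<close>

primrec Ck_on :: "nat \<Rightarrow> nat \<Rightarrow> fvec set \<Rightarrow> (fvec \<Rightarrow> 'b::real_normed_vector) \<Rightarrow> bool" where
  "Ck_on m 0 U G \<longleftrightarrow> continuous_on U G"
| "Ck_on m (Suc k) U G \<longleftrightarrow> continuous_on U G \<and>
     (\<forall>i<m. \<exists>D. (\<forall>x\<in>U. ((\<lambda>t. G (x + Poly_Mapping.single i t)) has_vector_derivative D x) (at 0)) \<and>
                Ck_on m k U D)"

definition Cr_on :: "nat \<Rightarrow> enat \<Rightarrow> fvec set \<Rightarrow> (fvec \<Rightarrow> 'b::real_normed_vector) \<Rightarrow> bool" where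
  "Cr_on m r U G \<longleftrightarrow> (\<forall>k. enat k \<le> r \<longrightarrow> Ck_on m k U G)"

definition Cr_map :: "enat \<Rightarrow> nat \<Rightarrow> fvec set \<Rightarrow> nat \<Rightarrow> fvec set \<Rightarrow> (fvec \<Rightarrow> fvec) \<Rightarrow> bool" where
  "Cr_map r m X n Y g \<longleftrightarrow> g ` X \<subseteq> Y \<and>
     (\<exists>U G. openin (top_of_set (Rn m)) U \<and> closedin (top_of_set U) X \<and>
            G ` U \<subseteq> Rn n \<and> Cr_on m r U G \<and> (\<forall>x\<in>X. g x = G x))"


section \<open>Function spaces and the strong topology\<close>

text \<open>
  Maps \<open>X \<rightarrow> Y\<close> are represented by functions with the value \<open>undefined\<close> outside \<open>X\<close>.
\<close>

definition C0_maps :: "fvec set \<Rightarrow> fvec set \<Rightarrow> (fvec \<Rightarrow> fvec) set" where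
  "C0_maps X Y = {f \<in> extensional X. continuous_on X f \<and> f ` X \<subseteq> Y}"

definition Cr_maps :: "enat \<Rightarrow> nat \<Rightarrow> fvec set \<Rightarrow> nat \<Rightarrow> fvec set \<Rightarrow> (fvec \<Rightarrow> fvec) set" where
  "Cr_maps r m X n Y = {f \<in> C0_maps X Y. Cr_map r m X n Y f}"

definition strong_nhd ::
    "fvec set \<Rightarrow> fvec set \<Rightarrow> (fvec \<Rightarrow> fvec) \<Rightarrow> (fvec \<Rightarrow> real) \<Rightarrow> (fvec \<Rightarrow> fvec) set" where
  "strong_nhd X Y f \<epsilon> = {g \<in> C0_maps X Y. \<forall>x\<in>X. enorm (g x - f x) < \<epsilon> x}"

definition strong_open :: "fvec set \<Rightarrow> fvec set \<Rightarrow> (fvec \<Rightarrow> fvec) set \<Rightarrow> bool" where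
  "strong_open X Y W \<longleftrightarrow> W \<subseteq> C0_maps X Y \<and>
     (\<forall>f\<in>W. \<exists>\<epsilon>. continuous_on X \<epsilon> \<and> (\<forall>x\<in>X. 0 < \<epsilon> x) \<and> strong_nhd X Y f \<epsilon> \<subseteq> W)"

definition strong_C0_topology :: "fvec set \<Rightarrow> fvec set \<Rightarrow> (fvec \<Rightarrow> fvec) topology" where
  "strong_C0_topology X Y = topology (strong_open X Y)"

lemma istopology_strong_open: "istopology (strong_open X Y)"
  unfolding istopology_def
proof (intro conjI allI impI)
  fix S T assume S: "strong_open X Y S" and T: "strong_open X Y T"
  show "strong_open X Y (S \<inter> T)"
    unfolding strong_open_def
  proof (intro conjI ballI)
    show "S \<inter> T \<subseteq> C0_maps X Y"
      using S by (auto simp: strong_open_def)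
    fix f assume f: "f \<in> S \<inter> T"
    obtain a where a: "continuous_on X a" "\<forall>x\<in>X. 0 < a x" "strong_nhd X Y f a \<subseteq> S"
      using S f unfolding strong_open_def by blast
    obtain b where b: "continuous_on X b" "\<forall>x\<in>X. 0 < b x" "strong_nhd X Y f b \<subseteq> T"
      using T f unfolding strong_open_def by blast
    have "strong_nhd X Y f (\<lambda>x. min (a x) (b x)) \<subseteq> S \<inter> T"
      using a(3) b(3) by (auto simp: strong_nhd_def)
    moreover have "continuous_on X (\<lambda>x. min (a x) (b x))"
      using a(1) b(1) by (rule continuous_on_min)
    ultimately show "\<exists>\<epsilon>. continuous_on X \<epsilon> \<and> (\<forall>x\<in>X. 0 < \<epsilon> x) \<and> strong_nhd X Y f \<epsilon> \<subseteq> S \<inter> T"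
      using a(2) b(2) by (intro exI[of _ "\<lambda>x. min (a x) (b x)"]) auto
  qed
next
  fix \<K> assume K: "\<forall>K\<in>\<K>. strong_open X Y K"
  show "strong_open X Y (\<Union>\<K>)"
    unfolding strong_open_def
  proof (intro conjI ballI)
    show "\<Union>\<K> \<subseteq> C0_maps X Y"
      using K by (auto simp: strong_open_def)
    fix f assume "f \<in> \<Union>\<K>"
    then obtain A where A: "A \<in> \<K>" "f \<in> A" by blast
    then obtain \<epsilon> where "continuous_on X \<epsilon>" "\<forall>x\<in>X. 0 < \<epsilon> x" "strong_nhd X Y f \<epsilon> \<subseteq> A"
      using K unfolding strong_open_def by blast
    with A show "\<exists>\<epsilon>. continuous_on X \<epsilon> \<and> (\<forall>x\<in>X. 0 < \<epsilon> x) \<and> strong_nhd X Y f \<epsilon> \<subseteq> \<Union>\<K>"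
      by blast
  qed
qed

lemma openin_strong_C0_topology: "openin (strong_C0_topology X Y) W \<longleftrightarrow> strong_open X Y W"
  unfolding strong_C0_topology_def by (simp add: istopology_strong_open topology_inverse')

lemma topspace_strong_C0_topology: "topspace (strong_C0_topology X Y) = C0_maps X Y"
proof -
  have "strong_open X Y (C0_maps X Y)"
    unfolding strong_open_def strong_nhd_def by (auto intro: exI[of _ "\<lambda>_. 1"])
  then show ?thesis
    unfolding topspace_def openin_strong_C0_topology by (auto simp: strong_open_def)
qed


section \<open>Simplicial complexes and triangulations\<close>

text \<open>
  The library notions \<open>simplex\<close> and \<open>simplicial_complex\<close> require a Euclidean space type
  and finitely many simplices.  Below, simplices are non-empty and closed, and \<open>face_of\<close>
  counts the empty set as a face, so two simplices may be disjoint.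
\<close>

definition is_simplex :: "fvec set \<Rightarrow> bool" where
  "is_simplex S \<longleftrightarrow> (\<exists>C. finite C \<and> C \<noteq> {} \<and> \<not> affine_dependent C \<and> S = convex hull C)"

definition locally_finite_complex :: "nat \<Rightarrow> fvec set set \<Rightarrow> bool" where
  "locally_finite_complex q L \<longleftrightarrow>
     (\<forall>S\<in>L. is_simplex S \<and> S \<subseteq> Rn q) \<and>
     (\<forall>S\<in>L. \<forall>F. F face_of S \<and> F \<noteq> {} \<longrightarrow> F \<in> L) \<and>
     (\<forall>S\<in>L. \<forall>T\<in>L. (S \<inter> T) face_of S \<and> (S \<inter> T) face_of T) \<and>
     (\<forall>x\<in>\<Union>L. \<exists>W. openin (top_of_set (\<Union>L)) W \<and> x \<in> W \<and> finite {S\<in>L. S \<inter> W \<noteq> {}})"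

definition triangulable :: "fvec set \<Rightarrow> bool" where
  "triangulable Y \<longleftrightarrow> Y \<noteq> {} \<and> (\<exists>q L. locally_finite_complex q L \<and> Y homeomorphic \<Union>L)"

definition weakly_Cr_triangulable :: "enat \<Rightarrow> nat \<Rightarrow> fvec set \<Rightarrow> bool" where
  "weakly_Cr_triangulable r n Y \<longleftrightarrow>
     (\<exists>q L \<Psi> \<Phi>. locally_finite_complex q L \<and> homeomorphism (\<Union>L) Y \<Psi> \<Phi> \<and>
        (\<forall>\<xi>\<in>L. Cr_map r q \<xi> n Y \<Psi>))"

definition Cr_approximation_target_space :: "enat \<Rightarrow> nat \<Rightarrow> fvec set \<Rightarrow> bool" where
  "Cr_approximation_target_space r n Y \<longleftrightarrow> triangulable Y \<and>
     (\<forall>m X. X \<subseteq> Rn m \<and> locally compact X \<longrightarrow>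
        strong_C0_topology X Y closure_of Cr_maps r m X n Y = topspace (strong_C0_topology X Y))"

end

theory Submission
  imports Defs "HOL-Computational_Algebra.Polynomial"
begin

text \<open>
  Let \<open>\<Psi>\<close> be a homeomorphism from the realization \<open>\<Union>L\<close> of the complex to \<open>Y\<close> with inverse
  \<open>\<Phi>\<close>, and let \<open>f : X \<rightarrow> Y\<close> be continuous.  Smoothing \<open>s = \<Phi> \<circ> f\<close> in the ambient space of
  \<open>\<Union>L\<close> is of no use, because \<open>\<Psi>\<close> is of class \<open>C\<^sup>r\<close> on each simplex but in general not across
  faces, and because a smoothed map may leave \<open>\<Union>L\<close>.  What is needed is a smooth map \<open>h\<close>, defined near
  \<open>X\<close> and close to \<open>s\<close>, which sends a neighborhood of every point of \<open>X\<close> into a single simplex.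
  Then \<open>\<Psi> \<circ> h\<close> is locally a composition of \<open>C\<^sup>r\<close> maps between open sets, hence \<open>C\<^sup>r\<close>.

  Such an \<open>h\<close> is a locally finite convex combination \<open>\<Sum>\<^sub>i \<omega>\<^sub>i s(y\<^sub>i)\<close> of values of \<open>s\<close>, with smooth
  weights \<open>\<omega>\<^sub>i\<close> supported in small boxes around \<open>y\<^sub>i\<close>.  The reason why it works is a
  semicontinuity of simplices: by local finiteness, every simplex that meets a small neighborhood
  of a point contains the point (\<open>simplices_near_point_contain_it\<close>).  So if the box around \<open>y\<^sub>i\<close>
  is small enough and contains \<open>x\<close>, then every simplex \<open>\<xi>\<close> through \<open>s(x)\<close> also contains \<open>s(y\<^sub>i)\<close>.
  The weights that are active near \<open>x\<close> have closed boxes containing \<open>x\<close>, so all the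
  values that are mixed near \<open>x\<close> lie in \<open>\<xi>\<close>, and by convexity \<open>h\<close> maps a neighborhood of \<open>x\<close>
  into \<open>\<xi>\<close>.  For example, if \<open>s\<close> is the identity of a polygon, then \<open>h\<close> is constant near
  each vertex.  Shrinking the boxes further makes \<open>\<Psi> \<circ> h\<close> as close to \<open>f\<close> as prescribed
  (\<open>Cr_approximation\<close>).

  The weights come from bump functions with plateaus (\<open>smooth_blending\<close>).  The regularity of
  \<open>\<Psi> \<circ> h\<close> rests on the chain rule for maps whose iterated partial derivatives are continuous
  (\<open>Ck_on_compose\<close>).
\<close>

section \<open>Coordinates of finitely supported sequences\<close>

lemma bounded_linear_lookup: "bounded_linear (\<lambda>x::fvec. Poly_Mapping.lookup x i)"
proof (rule bounded_linear_intro[where K=1])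
  fix x :: fvec
  show "norm (Poly_Mapping.lookup x i) \<le> norm x * 1"
    by (cases "i \<in> Poly_Mapping.keys x")
      (auto simp: norm_fvec in_keys_iff intro!: member_le_sum sum_nonneg)
qed (auto simp: lookup_add scaleR_poly_mapping_def map.rep_eq when_def)

lemma norm_single: "norm (Poly_Mapping.single i t :: fvec) = \<bar>t\<bar>"
  by (simp add: norm_fvec)

lemma bounded_linear_single: "bounded_linear (\<lambda>t. Poly_Mapping.single i t :: fvec)"
proof (rule bounded_linear_intro[where K=1])
  fix r t :: real
  show "(Poly_Mapping.single i (r *\<^sub>R t) :: fvec) = r *\<^sub>R Poly_Mapping.single i t"
    by (intro poly_mapping_eqI) (simp add: scaleR_poly_mapping_def map.rep_eq lookup_single when_def)
qed (auto simp: single_add norm_single)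

lemma norm_Rn: "x \<in> Rn n \<Longrightarrow> norm x = (\<Sum>i<n. \<bar>Poly_Mapping.lookup x i\<bar>)"
  unfolding norm_fvec Rn_def
  by (intro sum.mono_neutral_left) (auto simp: in_keys_iff)

lemma Rn_iff: "x \<in> Rn n \<longleftrightarrow> (\<forall>i\<ge>n. Poly_Mapping.lookup x i = 0)"
  unfolding Rn_def subset_iff in_keys_iff mem_Collect_eq lessThan_iff by (meson not_le)

section \<open>Calculus of maps of class \<open>C\<^sup>k\<close>\<close>

text \<open>
  Partial derivatives of \<open>G\<close> look at values of \<open>G\<close> near a point.  On a relatively open set
  these are values at points of the set, because a short coordinate segment stays inside.
\<close>

lemma open_line:
  assumes "openin (top_of_set (Rn m)) U" "x \<in> U" "i < m"
  shows "open {t. x + Poly_Mapping.single i t \<in> U}"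
proof -
  obtain W where W: "open W" "U = Rn m \<inter> W"
    using assms(1) by (auto simp: openin_open)
  have "x \<in> Rn m" using assms W by auto
  then have "{t. x + Poly_Mapping.single i t \<in> U} = (\<lambda>t. x + Poly_Mapping.single i t) -` W"
    using \<open>i < m\<close> by (auto simp: W(2) Rn_iff lookup_add lookup_single when_def)
  moreover have "open ((\<lambda>t. x + Poly_Mapping.single i t) -` W)"
    by (intro open_vimage W continuous_intros
          bounded_linear.continuous_on[OF bounded_linear_single] continuous_on_id)
  ultimately show ?thesis by simp
qed

text \<open>
  \<open>Ck_on\<close> provides derivatives by a separate existential on each set.  Fixing the derivative by
  \<open>vector_derivative\<close> makes the choices on overlapping sets agree, as needed for gluing in
  \<open>Ck_on_locally\<close>.
\<close>

definition partial :: "nat \<Rightarrow> (fvec \<Rightarrow> 'b::real_normed_vector) \<Rightarrow> fvec \<Rightarrow> 'b" where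
  "partial i G x = vector_derivative (\<lambda>t. G (x + Poly_Mapping.single i t)) (at 0)"

lemma Ck_on_imp_continuous_on: "Ck_on m k U G \<Longrightarrow> continuous_on U G"
  by (cases k) auto

text \<open>
  The derivatives in all directions are handled as one family \<open>D\<close>; with this pair of rules
  the inductions below never meet the existential quantifiers of \<open>Ck_on\<close>.
\<close>

lemma Ck_on_SucI:
  assumes "continuous_on U G"
    and "\<And>i x. i < m \<Longrightarrow> x \<in> U \<Longrightarrow>
      ((\<lambda>t. G (x + Poly_Mapping.single i t)) has_vector_derivative D i x) (at 0)"
    and "\<And>i. i < m \<Longrightarrow> Ck_on m k U (D i)"
  shows "Ck_on m (Suc k) U G"
  unfolding Ck_on.simps
proof (intro conjI allI impI)
  fix i assume "i < m"
  show "\<exists>E. (\<forall>x\<in>U. ((\<lambda>t. G (x + Poly_Mapping.single i t)) has_vector_derivative E x) (at 0))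
      \<and> Ck_on m k U E"
    by (intro exI[of _ "D i"] conjI ballI assms \<open>i < m\<close>)
qed (rule assms)

lemma Ck_on_SucE:
  assumes "Ck_on m (Suc k) U G"
  obtains D where "\<And>i x. i < m \<Longrightarrow> x \<in> U \<Longrightarrow>
      ((\<lambda>t. G (x + Poly_Mapping.single i t)) has_vector_derivative D i x) (at 0)"
    and "\<And>i. i < m \<Longrightarrow> Ck_on m k U (D i)"
proof -
  have "\<forall>i\<in>{..<m}. \<exists>D. (\<forall>x\<in>U. ((\<lambda>t. G (x + Poly_Mapping.single i t)) has_vector_derivative D x) (at 0))
      \<and> Ck_on m k U D"
    using assms unfolding Ck_on.simps by simp
  from bchoice[OF this] obtain D where D: "\<forall>i\<in>{..<m}.
      (\<forall>x\<in>U. ((\<lambda>t. G (x + Poly_Mapping.single i t)) has_vector_derivative D i x) (at 0))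
      \<and> Ck_on m k U (D i)" ..
  show ?thesis
    by (rule that[of D]) (use D in simp_all)
qed

lemma line_derivative_cong:
  assumes "openin (top_of_set (Rn m)) U" "x \<in> U" "i < m" "\<And>z. z \<in> U \<Longrightarrow> G z = H z"
    and "((\<lambda>t. G (x + Poly_Mapping.single i t)) has_vector_derivative d) (at 0)"
  shows "((\<lambda>t. H (x + Poly_Mapping.single i t)) has_vector_derivative d) (at 0)"
  by (rule has_vector_derivative_transform_within_open[OF assms(5) open_line[OF assms(1-3)]])
    (use assms(2,4) in auto)

lemma Ck_on_cong:
  assumes "openin (top_of_set (Rn m)) U" "\<And>z. z \<in> U \<Longrightarrow> G z = H z" "Ck_on m k U G"
  shows "Ck_on m k U H"
proof -
  have c: "continuous_on U H"
    using Ck_on_imp_continuous_on[OF assms(3)] continuous_on_cong[of U U G H] assms(2) by simp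
  show ?thesis
  proof (cases k)
    case 0
    then show ?thesis using c by simp
  next
    case (Suc l)
    obtain D where D: "\<And>i x. i < m \<Longrightarrow> x \<in> U \<Longrightarrow>
        ((\<lambda>t. G (x + Poly_Mapping.single i t)) has_vector_derivative D i x) (at 0)"
      "\<And>i. i < m \<Longrightarrow> Ck_on m l U (D i)"
      using assms(3) Ck_on_SucE unfolding Suc by blast
    show ?thesis
      unfolding Suc
      by (rule Ck_on_SucI[OF c line_derivative_cong[where G=G and H=H] D(2)])
        (use assms D(1) in auto)
  qed
qed

lemma Ck_on_SucD:
  assumes "openin (top_of_set (Rn m)) U" "Ck_on m (Suc k) U G" "i < m"
  shows "\<And>x. x \<in> U \<Longrightarrow>
      ((\<lambda>t. G (x + Poly_Mapping.single i t)) has_vector_derivative partial i G x) (at 0)"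
    and "Ck_on m k U (partial i G)"
proof -
  obtain D' where D': "\<And>i x. i < m \<Longrightarrow> x \<in> U \<Longrightarrow>
      ((\<lambda>t. G (x + Poly_Mapping.single i t)) has_vector_derivative D' i x) (at 0)"
      "\<And>i. i < m \<Longrightarrow> Ck_on m k U (D' i)"
    using Ck_on_SucE[OF assms(2)] by blast
  define D where "D = D' i"
  have D: "\<And>x. x \<in> U \<Longrightarrow>
      ((\<lambda>t. G (x + Poly_Mapping.single i t)) has_vector_derivative D x) (at 0)" "Ck_on m k U D"
    using D' assms(3) by (auto simp: D_def)
  have eq: "D x = partial i G x" if "x \<in> U" for x
    unfolding partial_def using D(1)[OF that] by (simp add: vector_derivative_at)
  show "((\<lambda>t. G (x + Poly_Mapping.single i t)) has_vector_derivative partial i G x) (at 0)"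
    if "x \<in> U" for x
    using D(1)[OF that] eq[OF that] by simp
  show "Ck_on m k U (partial i G)"
    using Ck_on_cong[OF assms(1) eq D(2)] .
qed

lemma Ck_on_subset: "Ck_on m k U G \<Longrightarrow> W \<subseteq> U \<Longrightarrow> Ck_on m k W G"
proof (induction k arbitrary: G)
  case 0
  then show ?case by (auto intro: continuous_on_subset)
next
  case (Suc k)
  from Suc.prems(1) obtain D where "\<And>i x. i < m \<Longrightarrow> x \<in> U \<Longrightarrow>
      ((\<lambda>t. G (x + Poly_Mapping.single i t)) has_vector_derivative D i x) (at 0)"
    "\<And>i. i < m \<Longrightarrow> Ck_on m k U (D i)"
    by (rule Ck_on_SucE) blast
  with Suc show ?case
    by (intro Ck_on_SucI[of _ _ _ D])
      (auto intro: continuous_on_subset[OF Ck_on_imp_continuous_on[OF Suc.prems(1)]])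
qed

lemma Ck_on_Suc_imp:
  "Ck_on m (Suc k) U G \<Longrightarrow> Ck_on m k U G"
proof (induction k arbitrary: G)
  case 0
  then show ?case by simp
next
  case (Suc k)
  from Suc.prems obtain D where "\<And>i x. i < m \<Longrightarrow> x \<in> U \<Longrightarrow>
      ((\<lambda>t. G (x + Poly_Mapping.single i t)) has_vector_derivative D i x) (at 0)"
    "\<And>i. i < m \<Longrightarrow> Ck_on m (Suc k) U (D i)"
    by (rule Ck_on_SucE) blast
  then show ?case
    by (rule Ck_on_SucI[OF Ck_on_imp_continuous_on[OF Suc.prems] _ Suc.IH])
qed

text \<open>
  Being of class \<open>C\<^sup>k\<close> is a local property, since \<open>partial i G\<close> is a single function whose
  restriction to each of the small sets is the derivative there.
\<close>

lemma Ck_on_locally: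
  assumes "\<And>x. x \<in> U \<Longrightarrow> \<exists>W. openin (top_of_set (Rn m)) W \<and> x \<in> W \<and> W \<subseteq> U \<and> Ck_on m k W G"
  shows "Ck_on m k U G"
  using assms
proof (induction k arbitrary: G)
  case (0 G)
  show ?case
    unfolding Ck_on.simps continuous_on_def
  proof
    fix x assume "x \<in> U"
    then obtain W where W: "openin (top_of_set (Rn m)) W" "x \<in> W" "W \<subseteq> U" "continuous_on W G"
      using 0 unfolding Ck_on.simps by blast
    obtain V where V: "open V" "W = Rn m \<inter> V"
      using W(1) by (auto simp: openin_open)
    have "U \<subseteq> Rn m"
      using 0 openin_imp_subset by blast
    then have "at x within U = at x within W"
      using V W by (intro at_within_nhd[of x V]) auto
    then show "(G \<longlongrightarrow> G x) (at x within U)"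
      using W(2,4) by (simp add: continuous_on_def)
  qed
next
  case (Suc k G)
  show ?case
  proof (rule Ck_on_SucI)
    show "continuous_on U G"
      using Suc.prems by (intro Ck_on_imp_continuous_on[of m k] Suc.IH) (blast dest: Ck_on_Suc_imp)
    show "((\<lambda>t. G (x + Poly_Mapping.single i t)) has_vector_derivative partial i G x) (at 0)"
      if i: "i < m" and x: "x \<in> U" for i x
    proof -
      obtain W where W: "openin (top_of_set (Rn m)) W" "x \<in> W" "Ck_on m (Suc k) W G"
        using Suc.prems[OF x] by blast
      show ?thesis by (rule Ck_on_SucD(1)[OF W(1,3) i W(2)])
    qed
    show "Ck_on m k U (partial i G)" if "i < m" for i
    proof (rule Suc.IH)
      fix x assume "x \<in> U"
      then obtain W where W: "openin (top_of_set (Rn m)) W" "x \<in> W" "W \<subseteq> U" "Ck_on m (Suc k) W G"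
        using Suc.prems by blast
      with Ck_on_SucD(2)[OF W(1,4) that]
      show "\<exists>W. openin (top_of_set (Rn m)) W \<and> x \<in> W \<and> W \<subseteq> U \<and> Ck_on m k W (partial i G)"
        by blast
    qed
  qed
qed

lemma Ck_on_const: "Ck_on m k U (\<lambda>_. c)"
proof (induction k arbitrary: c)
  case (Suc k)
  then show ?case by (intro Ck_on_SucI[of _ _ _ "\<lambda>_ _. 0"]) auto
qed simp

lemma Ck_on_bounded_linear:
  assumes "bounded_linear T"
  shows "Ck_on m k U G \<Longrightarrow> Ck_on m k U (\<lambda>x. T (G x))"
proof (induction k arbitrary: G)
  case 0
  then show ?case using bounded_linear.continuous_on[OF assms] by auto
next
  case (Suc k)
  from Suc.prems obtain D where D: "\<And>i x. i < m \<Longrightarrow> x \<in> U \<Longrightarrow>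
      ((\<lambda>t. G (x + Poly_Mapping.single i t)) has_vector_derivative D i x) (at 0)"
    "\<And>i. i < m \<Longrightarrow> Ck_on m k U (D i)"
    by (rule Ck_on_SucE) blast
  show ?case
    by (rule Ck_on_SucI[of _ _ _ "\<lambda>i x. T (D i x)"])
      (intro bounded_linear.continuous_on[OF assms] bounded_linear.has_vector_derivative[OF assms]
        Ck_on_imp_continuous_on[OF Suc.prems] Suc.IH D; assumption)+
qed

lemma Ck_on_add:
  "Ck_on m k U G \<Longrightarrow> Ck_on m k U H \<Longrightarrow> Ck_on m k U (\<lambda>x. G x + H x)"
proof (induction k arbitrary: G H)
  case 0
  then show ?case by (simp add: continuous_on_add)
next
  case (Suc k)
  from Suc.prems(1) obtain D where D: "\<And>i x. i < m \<Longrightarrow> x \<in> U \<Longrightarrow>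
      ((\<lambda>t. G (x + Poly_Mapping.single i t)) has_vector_derivative D i x) (at 0)"
    "\<And>i. i < m \<Longrightarrow> Ck_on m k U (D i)"
    by (rule Ck_on_SucE) blast
  from Suc.prems(2) obtain E where E: "\<And>i x. i < m \<Longrightarrow> x \<in> U \<Longrightarrow>
      ((\<lambda>t. H (x + Poly_Mapping.single i t)) has_vector_derivative E i x) (at 0)"
    "\<And>i. i < m \<Longrightarrow> Ck_on m k U (E i)"
    by (rule Ck_on_SucE) blast
  show ?case
    by (rule Ck_on_SucI[of _ _ _ "\<lambda>i x. D i x + E i x"])
      (intro continuous_on_add has_vector_derivative_add Suc.IH D E
        Ck_on_imp_continuous_on[OF Suc.prems(1)] Ck_on_imp_continuous_on[OF Suc.prems(2)]; assumption)+
qed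

lemma Ck_on_sum:
  "(\<And>i. i \<in> I \<Longrightarrow> Ck_on m k U (G i)) \<Longrightarrow> Ck_on m k U (\<lambda>x. \<Sum>i\<in>I. G i x)"
  by (induction I rule: infinite_finite_induct) (simp_all add: Ck_on_const Ck_on_add)

lemma Ck_on_scaleR:
  fixes f :: "fvec \<Rightarrow> real"
  shows "Ck_on m k U f \<Longrightarrow> Ck_on m k U G \<Longrightarrow> Ck_on m k U (\<lambda>x. f x *\<^sub>R G x)"
proof (induction k arbitrary: f G)
  case 0
  then show ?case by (simp add: continuous_on_scaleR)
next
  case (Suc k)
  from Suc.prems(1) obtain D where D: "\<And>i x. i < m \<Longrightarrow> x \<in> U \<Longrightarrow>
      ((\<lambda>t. f (x + Poly_Mapping.single i t)) has_vector_derivative D i x) (at 0)"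
    "\<And>i. i < m \<Longrightarrow> Ck_on m k U (D i)"
    by (rule Ck_on_SucE) blast
  from Suc.prems(2) obtain E where E: "\<And>i x. i < m \<Longrightarrow> x \<in> U \<Longrightarrow>
      ((\<lambda>t. G (x + Poly_Mapping.single i t)) has_vector_derivative E i x) (at 0)"
    "\<And>i. i < m \<Longrightarrow> Ck_on m k U (E i)"
    by (rule Ck_on_SucE) blast
  show ?case
  proof (rule Ck_on_SucI[of _ _ _ "\<lambda>i x. f x *\<^sub>R E i x + D i x *\<^sub>R G x"])
    show "continuous_on U (\<lambda>x. f x *\<^sub>R G x)"
      by (intro continuous_on_scaleR Suc.prems[THEN Ck_on_imp_continuous_on])
    show "((\<lambda>t. f (x + Poly_Mapping.single i t) *\<^sub>R G (x + Poly_Mapping.single i t))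
        has_vector_derivative (f x *\<^sub>R E i x + D i x *\<^sub>R G x)) (at 0)" if "i < m" "x \<in> U" for i x
      using bounded_bilinear.has_vector_derivative[OF bounded_bilinear_scaleR D(1)[OF that] E(1)[OF that]]
      by simp
    show "Ck_on m k U (\<lambda>x. f x *\<^sub>R E i x + D i x *\<^sub>R G x)" if "i < m" for i
      by (intro Ck_on_add Suc.IH Suc.prems[THEN Ck_on_Suc_imp] D E that)
  qed
qed

lemma Ck_on_mult:
  fixes f g :: "fvec \<Rightarrow> real"
  shows "Ck_on m k U f \<Longrightarrow> Ck_on m k U g \<Longrightarrow> Ck_on m k U (\<lambda>x. f x * g x)"
  using Ck_on_scaleR[of m k U f g] by simp

lemma Ck_on_prod:
  fixes f :: "'i \<Rightarrow> fvec \<Rightarrow> real"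
  shows "(\<And>i. i \<in> I \<Longrightarrow> Ck_on m k U (f i)) \<Longrightarrow> Ck_on m k U (\<lambda>x. \<Prod>i\<in>I. f i x)"
  by (induction I rule: infinite_finite_induct) (simp_all add: Ck_on_const Ck_on_mult)

lemma Ck_on_inverse:
  fixes f :: "fvec \<Rightarrow> real"
  assumes "\<And>x. x \<in> U \<Longrightarrow> f x \<noteq> 0"
  shows "Ck_on m k U f \<Longrightarrow> Ck_on m k U (\<lambda>x. inverse (f x))"
proof (induction k)
  case 0
  then show ?case using assms by (simp add: continuous_on_inverse)
next
  case (Suc k)
  from Suc.prems obtain D where D: "\<And>i x. i < m \<Longrightarrow> x \<in> U \<Longrightarrow>
      ((\<lambda>t. f (x + Poly_Mapping.single i t)) has_vector_derivative D i x) (at 0)"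
    "\<And>i. i < m \<Longrightarrow> Ck_on m k U (D i)"
    by (rule Ck_on_SucE) blast
  have IH: "Ck_on m k U (\<lambda>x. inverse (f x))"
    using Suc.IH Ck_on_Suc_imp[OF Suc.prems] .
  show ?case
  proof (rule Ck_on_SucI[of _ _ _ "\<lambda>i x. (-1) * (inverse (f x) * D i x * inverse (f x))"])
    show "continuous_on U (\<lambda>x. inverse (f x))"
      using assms Ck_on_imp_continuous_on[OF Suc.prems] by (simp add: continuous_on_inverse)
    show "Ck_on m k U (\<lambda>x. (-1) * (inverse (f x) * D i x * inverse (f x)))" if "i < m" for i
      by (intro Ck_on_mult IH D Ck_on_const that)
    show "((\<lambda>t. inverse (f (x + Poly_Mapping.single i t))) has_vector_derivative
        (-1) * (inverse (f x) * D i x * inverse (f x))) (at 0)" if "i < m" "x \<in> U" for i x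
      using DERIV_inverse'[OF D(1)[OF that, folded has_real_derivative_iff_has_vector_derivative]]
        assms[OF that(2)]
      by (simp add: has_real_derivative_iff_has_vector_derivative)
  qed
qed

section \<open>The chain rule\<close>

text \<open>
  The usual bridge from partial to total derivatives: \<open>p\<close> and a nearby point \<open>y\<close> are joined by a
  path of \<open>q\<close> coordinate segments, and on each of them the mean value inequality compares \<open>G\<close>
  with its linearization at \<open>p\<close>.  The errors add up to \<open>e * norm (y - p)\<close> because the norm is
  the sum of the moduli of the coordinates.
\<close>

lemma has_derivative_if_continuous_partials:
  assumes V: "openin (top_of_set (Rn q)) V" and p: "p \<in> V"
    and D: "\<And>j x. j < q \<Longrightarrow> x \<in> V \<Longrightarrow>
      ((\<lambda>t. G (x + Poly_Mapping.single j t)) has_vector_derivative D j x) (at 0)"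
    and cont: "\<And>j. j < q \<Longrightarrow> continuous_on V (D j)"
  shows "(G has_derivative (\<lambda>v. \<Sum>j<q. Poly_Mapping.lookup v j *\<^sub>R D j p)) (at p within V)"
  unfolding has_derivative_within_alt
proof (intro conjI allI impI)
  show "bounded_linear (\<lambda>v. \<Sum>j<q. Poly_Mapping.lookup v j *\<^sub>R D j p)"
    by (intro bounded_linear_sum bounded_linear_compose[OF bounded_linear_scaleR_left]
          bounded_linear_lookup)
  fix e :: real assume "0 < e"
  have VR: "V \<subseteq> Rn q"
    using V openin_imp_subset by blast
  have "\<forall>j\<in>{..<q}. \<forall>\<^sub>F z in at p within V. dist (D j z) (D j p) < e"
    using cont p \<open>0 < e\<close> by (auto simp: continuous_on_def tendsto_iff)
  then have "\<forall>\<^sub>F z in at p within V. \<forall>j\<in>{..<q}. dist (D j z) (D j p) < e"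
    by (rule eventually_ball_finite[rotated]) simp
  then obtain d1 where d1: "0 < d1"
    "\<And>z j. z \<in> V \<Longrightarrow> z \<noteq> p \<Longrightarrow> dist z p < d1 \<Longrightarrow> j < q \<Longrightarrow> dist (D j z) (D j p) < e"
    unfolding eventually_at by auto
  obtain d2 where d2: "0 < d2" "\<And>z. z \<in> Rn q \<Longrightarrow> dist z p < d2 \<Longrightarrow> z \<in> V"
    using V p unfolding openin_euclidean_subtopology_iff by blast
  define d where "d = min d1 d2"
  show "\<exists>d>0. \<forall>y\<in>V. norm (y - p) < d \<longrightarrow>
      norm (G y - G p - (\<Sum>j<q. Poly_Mapping.lookup (y - p) j *\<^sub>R D j p)) \<le> e * norm (y - p)"
  proof (intro exI[of _ d] conjI ballI impI)
    show "0 < d" using d1 d2 by (simp add: d_def)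
    fix y assume y: "y \<in> V" "norm (y - p) < d"
    define a where "a j = Poly_Mapping.lookup y j - Poly_Mapping.lookup p j" for j
    \<comment> \<open>\<open>w 0, \<dots>, w q\<close> leads from \<open>p\<close> to \<open>y\<close>, correcting one coordinate at a time.\<close>
    define w where "w j = p + (\<Sum>i<j. Poly_Mapping.single i (a i))" for j
    have pR: "p \<in> Rn q" and yR: "y \<in> Rn q" using p y VR by auto
    have lookup_w: "Poly_Mapping.lookup (w j) i = Poly_Mapping.lookup p i + (if i < j then a i else 0)" for i j
      by (simp add: w_def lookup_add lookup_sum lookup_single when_def)
    have w0: "w 0 = p" by (simp add: w_def)
    have wq: "w q = y"
      using pR yR by (intro poly_mapping_eqI) (auto simp: lookup_w a_def Rn_iff)
    have wS: "w (Suc j) = w j + Poly_Mapping.single j (a j)" for j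
      by (simp add: w_def add.assoc)
    have ny: "norm (y - p) = (\<Sum>j<q. \<bar>a j\<bar>)"
      using pR yR by (subst norm_Rn[of _ q]) (auto simp: Rn_iff lookup_minus a_def)
    have step: "norm (G (w (Suc j)) - G (w j) - a j *\<^sub>R D j p) \<le> e * \<bar>a j\<bar>" if j: "j < q" for j
    proof -
      define S where "S = closed_segment 0 (a j)"
      have line: "w j + Poly_Mapping.single j t \<in> V" "dist (D j (w j + Poly_Mapping.single j t)) (D j p) \<le> e"
        if t: "t \<in> S" for t
      proof -
        have tl: "\<bar>t\<bar> \<le> \<bar>a j\<bar>"
          using t by (auto simp: S_def closed_segment_eq_real_ivl split: if_splits)
        have R: "w j + Poly_Mapping.single j t \<in> Rn q"
          using pR j by (auto simp: Rn_iff lookup_add lookup_w lookup_single when_def)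
        then have "w j + Poly_Mapping.single j t - p \<in> Rn q"
          using pR by (auto simp: Rn_iff lookup_minus)
        then have "norm (w j + Poly_Mapping.single j t - p)
            = (\<Sum>i<q. \<bar>Poly_Mapping.lookup (w j + Poly_Mapping.single j t - p) i\<bar>)"
          by (rule norm_Rn)
        also have "\<dots> \<le> (\<Sum>i<q. \<bar>a i\<bar>)"
          using tl by (intro sum_mono) (auto simp: lookup_minus lookup_add lookup_w lookup_single when_def)
        finally have "dist (w j + Poly_Mapping.single j t) p < d"
          using y(2) ny by (simp add: dist_norm)
        then have dd: "dist (w j + Poly_Mapping.single j t) p < d1" "dist (w j + Poly_Mapping.single j t) p < d2"
          by (auto simp: d_def)
        show "w j + Poly_Mapping.single j t \<in> V"
          using d2(2) R dd by blast
        then show "dist (D j (w j + Poly_Mapping.single j t)) (D j p) \<le> e"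
          using d1(2) dd(1) j \<open>0 < e\<close> by (cases "w j + Poly_Mapping.single j t = p") (auto intro: less_imp_le)
      qed
      have scaleR_line: "((\<lambda>t. t *\<^sub>R D j p) has_vector_derivative D j p) (at t within S)" for t
        by (auto intro!: derivative_eq_intros)
      have hv: "((\<lambda>t. G (w j + Poly_Mapping.single j t) - t *\<^sub>R D j p) has_vector_derivative
          D j (w j + Poly_Mapping.single j t) - D j p) (at t within S)" if t: "t \<in> S" for t
      proof -
        let ?g = "\<lambda>t. G (w j + Poly_Mapping.single j t)"
        have "((\<lambda>s. ?g (t + s)) has_vector_derivative D j (w j + Poly_Mapping.single j t)) (at 0)"
          using D[OF j line(1)[OF t]] by (simp add: single_add add.assoc)
        moreover have "((\<lambda>s. s - t) has_vector_derivative 1) (at t)"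
          by (auto intro!: derivative_eq_intros)
        ultimately have "((\<lambda>s. ?g (t + s)) \<circ> (\<lambda>s. s - t) has_vector_derivative
            1 *\<^sub>R D j (w j + Poly_Mapping.single j t)) (at t)"
          by (intro vector_diff_chain_at) simp_all
        then have "(?g has_vector_derivative D j (w j + Poly_Mapping.single j t)) (at t)"
          by (simp add: o_def)
        then show ?thesis
          by (intro has_vector_derivative_diff[OF has_vector_derivative_at_within scaleR_line])
      qed
      have "norm ((G (w j + Poly_Mapping.single j (a j)) - a j *\<^sub>R D j p)
          - (G (w j + Poly_Mapping.single j 0) - 0 *\<^sub>R D j p)) \<le> e * norm (a j - 0)"
      proof (rule differentiable_bound[where S=S])
        show "((\<lambda>t. G (w j + Poly_Mapping.single j t) - t *\<^sub>R D j p) has_derivative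
          (\<lambda>s. s *\<^sub>R (D j (w j + Poly_Mapping.single j t) - D j p))) (at t within S)" if "t \<in> S" for t
          using hv[OF that] by (simp add: has_vector_derivative_def)
        show "onorm (\<lambda>s. s *\<^sub>R (D j (w j + Poly_Mapping.single j t) - D j p)) \<le> e" if "t \<in> S" for t
          using line(2)[OF that] \<open>0 < e\<close>
          by (intro onorm_bound) (auto simp: dist_norm mult.commute[of e] intro!: mult_left_mono)
      qed (auto simp: S_def)
      then show ?thesis
        by (simp add: wS algebra_simps)
    qed
    have "G y - G p - (\<Sum>j<q. Poly_Mapping.lookup (y - p) j *\<^sub>R D j p)
        = (\<Sum>j<q. G (w (Suc j)) - G (w j) - a j *\<^sub>R D j p)"
      using sum_lessThan_telescope[of "\<lambda>j. G (w j)" q]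
      by (simp add: sum_subtractf w0 wq lookup_minus a_def)
    also have "norm \<dots> \<le> (\<Sum>j<q. e * \<bar>a j\<bar>)"
      using step by (intro sum_norm_le) auto
    also have "\<dots> = e * norm (y - p)"
      by (simp add: ny sum_distrib_left)
    finally show "norm (G y - G p - (\<Sum>j<q. Poly_Mapping.lookup (y - p) j *\<^sub>R D j p)) \<le> e * norm (y - p)" .
  qed
qed

text \<open>
  The partial derivative of \<open>G \<circ> h\<close> is \<open>\<Sum>\<^sub>j (D\<^sub>i h)\<^sub>j * (D\<^sub>j G \<circ> h)\<close>, to which the induction
  hypothesis and the rules for sums and products apply.
\<close>

lemma Ck_on_compose:
  assumes U: "openin (top_of_set (Rn m)) U" and V: "openin (top_of_set (Rn q)) V"
    and hUV: "h ` U \<subseteq> V"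
  shows "Ck_on m k U h \<Longrightarrow> Ck_on q k V G \<Longrightarrow> Ck_on m k U (\<lambda>x. G (h x))"
proof (induction k arbitrary: G)
  case 0
  then show ?case using continuous_on_compose2[of V G U h] hUV by simp
next
  case (Suc k)
  from Suc.prems(1) obtain D where D: "\<And>i x. i < m \<Longrightarrow> x \<in> U \<Longrightarrow>
      ((\<lambda>t. h (x + Poly_Mapping.single i t)) has_vector_derivative D i x) (at 0)"
    "\<And>i. i < m \<Longrightarrow> Ck_on m k U (D i)"
    by (rule Ck_on_SucE) blast
  from Suc.prems(2) obtain E where E: "\<And>j x. j < q \<Longrightarrow> x \<in> V \<Longrightarrow>
      ((\<lambda>t. G (x + Poly_Mapping.single j t)) has_vector_derivative E j x) (at 0)"
    "\<And>j. j < q \<Longrightarrow> Ck_on q k V (E j)"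
    by (rule Ck_on_SucE) blast
  show ?case
  proof (rule Ck_on_SucI[of _ _ _ "\<lambda>i x. \<Sum>j<q. Poly_Mapping.lookup (D i x) j *\<^sub>R E j (h x)"])
    show "continuous_on U (\<lambda>x. G (h x))"
      using continuous_on_compose2[of V G U h] hUV Suc.prems[THEN Ck_on_imp_continuous_on] by simp
    show "Ck_on m k U (\<lambda>x. \<Sum>j<q. Poly_Mapping.lookup (D i x) j *\<^sub>R E j (h x))" if "i < m" for i
      using that by (intro Ck_on_sum Ck_on_scaleR Ck_on_bounded_linear[OF bounded_linear_lookup] D
          Suc.IH E Ck_on_Suc_imp[OF Suc.prems(1)]) auto
    fix i x assume i: "i < m" and x: "x \<in> U"
    define N where "N = {t. x + Poly_Mapping.single i t \<in> U}"
    have N: "open N" "0 \<in> N"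
      using open_line[OF U x i] x by (auto simp: N_def)
    have "(G has_derivative (\<lambda>v. \<Sum>j<q. Poly_Mapping.lookup v j *\<^sub>R E j (h x))) (at (h x) within V)"
      using x hUV E by (intro has_derivative_if_continuous_partials[OF V] Ck_on_imp_continuous_on[OF E(2)]) auto
    moreover have "(\<lambda>t. h (x + Poly_Mapping.single i t)) ` N \<subseteq> V"
      using hUV by (auto simp: N_def)
    ultimately have "((\<lambda>t. G (h (x + Poly_Mapping.single i t))) has_derivative
        (\<lambda>t. \<Sum>j<q. Poly_Mapping.lookup (t *\<^sub>R D i x) j *\<^sub>R E j (h x))) (at 0 within N)"
      using D(1)[OF i x, unfolded has_vector_derivative_def, THEN has_derivative_at_withinI]
      by (intro has_derivative_in_compose[where f="\<lambda>t. h (x + Poly_Mapping.single i t)" and g=G])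
        (auto elim: has_derivative_subset)
    then show "((\<lambda>t. G (h (x + Poly_Mapping.single i t))) has_vector_derivative
        (\<Sum>j<q. Poly_Mapping.lookup (D i x) j *\<^sub>R E j (h x))) (at 0)"
      using linear_scale[OF bounded_linear.linear[OF bounded_linear_lookup]]
      unfolding has_vector_derivative_def at_within_open[OF N(2,1)] scaleR_sum_right by simp
  qed
qed

section \<open>Smooth bump functions\<close>

text \<open>
  For \<open>p = 1\<close> this is the standard smooth function that is positive exactly on the positive
  half-line.  The polynomial factor makes the family closed under differentiation, so a single
  computation of a derivative gives derivatives of all orders.
\<close>

definition flat :: "real poly \<Rightarrow> real \<Rightarrow> real" where
  "flat p t = (if 0 < t then poly p (1 / t) * exp (- (1 / t)) else 0)"

lemma poly_times_exp_tendsto_0: "((\<lambda>u::real. poly p u * exp (- u)) \<longlongrightarrow> 0) at_top"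
proof -
  have "((\<lambda>u::real. \<Sum>i\<le>degree p. coeff p i * (u ^ i / exp u)) \<longlongrightarrow> (\<Sum>i\<le>degree p. coeff p i * 0)) at_top"
    by (intro tendsto_intros tendsto_power_div_exp_0)
  then show ?thesis
    by (simp add: poly_altdef exp_minus divide_inverse sum_distrib_right mult.assoc)
qed

text \<open>
  For \<open>t > 0\<close> the polynomial \<open>u\<^sup>2 (p(u) - p'(u))\<close> in \<open>u = 1 / t\<close> comes from the product rule.  At
  \<open>0\<close> the difference quotient from the right is \<open>u p(u) exp (- u)\<close> with \<open>u\<close> tending to infinity.
\<close>

lemma flat_has_derivative:
  "(flat p has_real_derivative flat (monom 1 2 * (p - pderiv p)) t) (at t)"
proof -
  consider "t > 0" | "t < 0" | "t = 0" by linarith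
  then show ?thesis
  proof cases
    case 1
    have "((\<lambda>t. poly p (1 / t) * exp (- (1 / t))) has_real_derivative
        flat (monom 1 2 * (p - pderiv p)) t) (at t)"
      using 1 by (auto intro!: derivative_eq_intros simp: flat_def poly_monom power2_eq_square field_simps)
    then show ?thesis
      by (rule has_field_derivative_transform_within_open[where S="{0<..}"]) (use 1 in \<open>auto simp: flat_def\<close>)
  next
    case 2
    have "((\<lambda>t. 0) has_real_derivative flat (monom 1 2 * (p - pderiv p)) t) (at t)"
      using 2 by (simp add: flat_def)
    then show ?thesis
      by (rule has_field_derivative_transform_within_open[where S="{..<0}"]) (use 2 in \<open>auto simp: flat_def\<close>)
  next
    case 3
    have "((\<lambda>h. flat p h / h) \<longlongrightarrow> 0) (at_left 0)"
      by (rule Lim_transform_eventually[of "\<lambda>_. 0"])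
        (auto simp: eventually_at_left_field flat_def intro!: exI[of _ "-1"])
    moreover have "((\<lambda>h. flat p h / h) \<longlongrightarrow> 0) (at_right 0)"
    proof (rule Lim_transform_eventually)
      show "((\<lambda>h. poly (pCons 0 p) (inverse h) * exp (- inverse h)) \<longlongrightarrow> 0) (at_right 0)"
        by (rule filterlim_compose[OF poly_times_exp_tendsto_0 filterlim_inverse_at_top_right])
      show "\<forall>\<^sub>F h in at_right 0. poly (pCons 0 p) (inverse h) * exp (- inverse h) = flat p h / h"
        by (auto simp: eventually_at_right_field flat_def divide_inverse intro!: exI[of _ 1])
    qed
    ultimately have "((\<lambda>h. flat p h / h) \<longlongrightarrow> 0) (at 0)"
      by (simp add: filterlim_at_split)
    then show ?thesis
      using 3 by (simp add: has_field_derivative_iff flat_def)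
  qed
qed

lemma Ck_on_flat: "Ck_on m k U (\<lambda>z. flat p (\<alpha> * Poly_Mapping.lookup z j + \<beta>))"
proof (induction k arbitrary: p)
  case 0
  have "continuous_on UNIV (flat p)"
    using flat_has_derivative DERIV_isCont continuous_at_imp_continuous_on by blast
  then show ?case
    by (auto intro!: continuous_on_compose2[of UNIV "flat p"] continuous_intros continuous_on_lookup)
next
  case (Suc k)
  let ?D = "\<lambda>p z. flat p (\<alpha> * Poly_Mapping.lookup z j + \<beta>)"
  let ?p' = "monom 1 2 * (p - pderiv p)"
  show ?case
  proof (rule Ck_on_SucI[of _ _ _ "\<lambda>i z. (if i = j then \<alpha> else 0) * ?D ?p' z"])
    have "continuous_on UNIV (flat p)"
      using flat_has_derivative DERIV_isCont continuous_at_imp_continuous_on by blast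
    then show "continuous_on U (?D p)"
      by (auto intro!: continuous_on_compose2[of UNIV "flat p"] continuous_intros continuous_on_lookup)
    show "Ck_on m k U (\<lambda>z. (if i = j then \<alpha> else 0) * ?D ?p' z)" for i
      by (intro Ck_on_mult Ck_on_const Suc.IH)
    show "((\<lambda>t. ?D p (z + Poly_Mapping.single i t)) has_vector_derivative
        (if i = j then \<alpha> else 0) * ?D ?p' z) (at 0)" for i z
    proof -
      have "((\<lambda>t. \<alpha> * (Poly_Mapping.lookup z j + (if i = j then t else 0)) + \<beta>) has_real_derivative
          (if i = j then \<alpha> else 0)) (at 0)"
        by (auto intro!: derivative_eq_intros)
      from DERIV_chain2[OF flat_has_derivative this, of p] show ?thesis
        by (simp add: lookup_add lookup_single when_def has_real_derivative_iff_has_vector_derivative mult.commute)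
    qed
  qed
qed

definition step_fn :: "real \<Rightarrow> real" where
  "step_fn t = flat 1 t * inverse (flat 1 t + flat 1 (1 - t))"

lemma flat_1: "flat 1 t \<ge> 0" "0 < t \<Longrightarrow> flat 1 t > 0" "t \<le> 0 \<Longrightarrow> flat 1 t = 0"
  by (auto simp: flat_def)

lemma step_fn_denominator: "flat 1 t + flat 1 (1 - t) > 0"
  using flat_1(1)[of t] flat_1(1)[of "1 - t"] flat_1(2)[of t] flat_1(2)[of "1 - t"] by (cases "0 < t") auto

lemma step_fn_range: "0 \<le> step_fn t" "step_fn t \<le> 1"
  using step_fn_denominator[of t] flat_1(1)[of t] flat_1(1)[of "1 - t"]
  by (auto simp: step_fn_def divide_inverse[symmetric])

lemma step_fn_eq: "t \<le> 0 \<Longrightarrow> step_fn t = 0" "1 \<le> t \<Longrightarrow> step_fn t = 1"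
  using step_fn_denominator[of t] flat_1(3)[of t] flat_1(3)[of "1 - t"] by (auto simp: step_fn_def)

lemma Ck_on_step_fn: "Ck_on m k U (\<lambda>z. step_fn (\<alpha> * Poly_Mapping.lookup z j + \<beta>))"
proof -
  have "Ck_on m k U (\<lambda>z. flat 1 (\<alpha> * Poly_Mapping.lookup z j + \<beta>) *
      inverse (flat 1 (\<alpha> * Poly_Mapping.lookup z j + \<beta>) + flat 1 ((- \<alpha>) * Poly_Mapping.lookup z j + (1 - \<beta>))))"
  proof (intro Ck_on_mult Ck_on_inverse Ck_on_add Ck_on_flat)
    fix z :: fvec
    show "flat 1 (\<alpha> * Poly_Mapping.lookup z j + \<beta>) + flat 1 ((- \<alpha>) * Poly_Mapping.lookup z j + (1 - \<beta>)) \<noteq> 0"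
      using step_fn_denominator[of "\<alpha> * Poly_Mapping.lookup z j + \<beta>"] by (simp add: algebra_simps)
  qed
  then show ?thesis
    by (simp add: step_fn_def algebra_simps)
qed

text \<open>
  Two opposite steps, one on each side, give a function that equals \<open>1\<close> near \<open>0\<close>, and not
  only at \<open>0\<close>.  Writing \<open>\<bar>u\<bar>\<close> in a single step instead would conceal the smoothness at \<open>0\<close>.
\<close>

definition plateau :: "real \<Rightarrow> real" where
  "plateau u = step_fn (2 - 2 * u) * step_fn (2 + 2 * u)"

lemma plateau_range: "0 \<le> plateau u" "plateau u \<le> 1"
  unfolding plateau_def by (auto intro!: mult_nonneg_nonneg mult_le_one step_fn_range)

lemma plateau_eq_1: "\<bar>u\<bar> \<le> 1 / 2 \<Longrightarrow> plateau u = 1"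
  by (auto simp: plateau_def step_fn_eq abs_le_iff)

lemma plateau_eq_0: "1 \<le> \<bar>u\<bar> \<Longrightarrow> plateau u = 0"
  by (cases "0 \<le> u") (auto simp: plateau_def step_fn_eq)

definition bump :: "nat \<Rightarrow> fvec \<Rightarrow> real \<Rightarrow> fvec \<Rightarrow> real" where
  "bump m y \<rho> z = (\<Prod>j<m. plateau ((Poly_Mapping.lookup z j - Poly_Mapping.lookup y j) / \<rho>))"

lemma Ck_on_bump: "Ck_on m k U (bump m y \<rho>)"
proof -
  have affine: "2 - 2 * ((t - c) / \<rho>) = (- 2 / \<rho>) * t + (2 + 2 * c / \<rho>)"
    "2 + 2 * ((t - c) / \<rho>) = (2 / \<rho>) * t + (2 - 2 * c / \<rho>)" for t c :: real
    by (auto simp: diff_divide_distrib right_diff_distrib)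
  show ?thesis
    unfolding bump_def plateau_def affine by (intro Ck_on_prod Ck_on_mult Ck_on_step_fn)
qed

lemma bump_range: "0 \<le> bump m y \<rho> z" "bump m y \<rho> z \<le> 1"
  unfolding bump_def by (simp_all add: prod_nonneg prod_le_1 plateau_range)

lemma bump_eq_1:
  assumes "0 < \<rho>" "\<And>j. j < m \<Longrightarrow> \<bar>Poly_Mapping.lookup z j - Poly_Mapping.lookup y j\<bar> \<le> \<rho> / 2"
  shows "bump m y \<rho> z = 1"
  unfolding bump_def
  by (rule prod.neutral) (use assms in \<open>auto intro!: plateau_eq_1 simp: field_simps\<close>)

lemma bump_nonzero:
  assumes "0 < \<rho>" "bump m y \<rho> z \<noteq> 0" "j < m"
  shows "\<bar>Poly_Mapping.lookup z j - Poly_Mapping.lookup y j\<bar> \<le> \<rho>"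
proof -
  have "plateau ((Poly_Mapping.lookup z j - Poly_Mapping.lookup y j) / \<rho>) \<noteq> 0"
    using assms(2,3) unfolding bump_def by (simp add: prod_zero_iff)
  then have "\<bar>(Poly_Mapping.lookup z j - Poly_Mapping.lookup y j) / \<rho>\<bar> < 1"
    using plateau_eq_0 not_less by blast
  then show ?thesis
    using assms(1) by simp
qed

section \<open>Smooth blending of prescribed values\<close>

lemma box_subset_nhd:
  assumes "open N" "y \<in> N" "y \<in> Rn m"
  obtains \<rho> where "0 < \<rho>"
    "\<And>z. z \<in> Rn m \<Longrightarrow> (\<And>j. j < m \<Longrightarrow> \<bar>Poly_Mapping.lookup z j - Poly_Mapping.lookup y j\<bar> \<le> \<rho>) \<Longrightarrow> z \<in> N"
proof -
  obtain e where e: "0 < e" "ball y e \<subseteq> N"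
    using assms(1,2) open_contains_ball by blast
  show ?thesis
  proof (rule that[of "e / (real m + 1)"])
    show "0 < e / (real m + 1)" using e by simp
    fix z assume z: "z \<in> Rn m"
      "\<And>j. j < m \<Longrightarrow> \<bar>Poly_Mapping.lookup z j - Poly_Mapping.lookup y j\<bar> \<le> e / (real m + 1)"
    have "z - y \<in> Rn m"
      using z(1) assms(3) by (simp add: Rn_iff lookup_minus)
    then have "norm (z - y) = (\<Sum>j<m. \<bar>Poly_Mapping.lookup z j - Poly_Mapping.lookup y j\<bar>)"
      by (simp add: norm_Rn lookup_minus)
    also have "\<dots> \<le> (\<Sum>j<m. e / (real m + 1))"
      using z(2) by (intro sum_mono) auto
    also have "\<dots> < e"
      using e by (simp add: field_simps)
    finally show "z \<in> N"
      using e(2) by (auto simp: dist_norm norm_minus_commute)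
  qed
qed

text \<open>
  This is the Lindeloef property.  It is applied in the second countable space of all real
  sequences, where the boxes are open as well since they constrain only finitely many
  coordinates.
\<close>

lemma countable_box_cover:
  assumes "X \<subseteq> Rn m" "X \<noteq> {}" "\<And>y. y \<in> X \<Longrightarrow> 0 < \<rho> y"
  obtains s :: "nat \<Rightarrow> fvec" where "range s \<subseteq> X"
    "\<And>x. x \<in> X \<Longrightarrow> \<exists>i. \<forall>j<m. \<bar>Poly_Mapping.lookup x j - Poly_Mapping.lookup (s i) j\<bar> < \<rho> (s i)"
proof -
  define B where "B y = {w::nat \<Rightarrow> real. \<forall>j<m. \<bar>w j - Poly_Mapping.lookup y j\<bar> < \<rho> y}" for y
  have open_coord: "open {w::nat \<Rightarrow> real. \<bar>w j - c\<bar> < r}" for j c r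
    by (intro open_Collect_less continuous_intros continuous_on_product_coordinates)
  have "open (B y)" for y
  proof -
    have "B y = (\<Inter>j\<in>{..<m}. {w. \<bar>w j - Poly_Mapping.lookup y j\<bar> < \<rho> y})"
      by (auto simp: B_def)
    then show ?thesis using open_coord by (auto intro!: open_INT)
  qed
  then have "\<And>S. S \<in> B ` X \<Longrightarrow> open S" by auto
  then obtain \<F> where F: "\<F> \<subseteq> B ` X" "countable \<F>" "\<Union>\<F> = \<Union>(B ` X)"
    using Lindelof[of "B ` X"] by blast
  obtain C where C: "countable C" "C \<subseteq> X" "\<F> = B ` C"
    using F(1,2) countable_subset_image[of \<F> B X] by blast
  have cov: "\<exists>y\<in>C. Poly_Mapping.lookup x \<in> B y" if "x \<in> X" for x
  proof -
    have "Poly_Mapping.lookup x \<in> B x"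
      using assms(3)[OF that] by (simp add: B_def)
    then have "Poly_Mapping.lookup x \<in> \<Union>\<F>" using that F(3) by blast
    then show ?thesis using C by blast
  qed
  then have "C \<noteq> {}" using assms(2) by blast
  show ?thesis
  proof (rule that[of "from_nat_into C"])
    show "range (from_nat_into C) \<subseteq> X"
      using from_nat_into[OF \<open>C \<noteq> {}\<close>] C(2) by blast
    fix x assume "x \<in> X"
    then obtain y where y: "y \<in> C" "Poly_Mapping.lookup x \<in> B y" using cov by blast
    then obtain i where "from_nat_into C i = y"
      using from_nat_into_surj[OF C(1)] by blast
    then show "\<exists>i. \<forall>j<m. \<bar>Poly_Mapping.lookup x j - Poly_Mapping.lookup (from_nat_into C i) j\<bar>
        < \<rho> (from_nat_into C i)"
      using y(2) by (intro exI[of _ i]) (simp add: B_def)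
  qed
qed

text \<open>
  The \<open>i\<close>-th summand is the drop of \<open>\<Prod>j<i. 1 - \<psi> j\<close> to its value for \<open>i + 1\<close>, so the sum
  telescopes.
\<close>

lemma sum_times_prod_complements:
  fixes \<psi> :: "nat \<Rightarrow> 'a::comm_ring_1"
  shows "(\<Sum>i<n. \<psi> i * (\<Prod>j<i. 1 - \<psi> j)) = 1 - (\<Prod>j<n. 1 - \<psi> j)"
  by (induction n) (auto simp: algebra_simps)

text \<open>
  Every point \<open>y\<close> offers a value \<open>c y\<close> and a neighborhood \<open>N y\<close> in which this value may be used.
  The map \<open>h\<close> is a smooth mixture of such values: near \<open>x\<close> it uses finitely many of
  them, all offered by points whose neighborhood contains \<open>x\<close>.  The set \<open>I\<close> is the same for
  all of \<open>W\<close>, which is what later puts \<open>h ` W\<close> into one simplex.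

  The bump functions \<open>\<psi> i\<close> of a countable cover are turned into weights
  \<open>\<omega> i = \<psi> i * (\<Prod>j<i. 1 - \<psi> j)\<close>.  Where \<open>\<psi> n = 1\<close>, all weights after the \<open>n\<close>-th vanish and the
  others add up to \<open>1\<close>.  Since \<open>\<psi> n\<close> is constantly \<open>1\<close> on an open box and these boxes cover
  \<open>X\<close>, the weights form a locally finite smooth partition of unity on a neighborhood of \<open>X\<close>,
  although the cover itself need not be locally finite.
\<close>

lemma smooth_blending:
  fixes c :: "fvec \<Rightarrow> 'b::real_normed_vector"
  assumes XR: "X \<subseteq> Rn m" and N: "\<And>y. y \<in> X \<Longrightarrow> open (N y)" "\<And>y. y \<in> X \<Longrightarrow> y \<in> N y"
  obtains h where "\<And>x. x \<in> X \<Longrightarrow> \<exists>W I. openin (top_of_set (Rn m)) W \<and> x \<in> W \<and>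
      finite I \<and> I \<subseteq> {y\<in>X. x \<in> N y} \<and> h ` W \<subseteq> convex hull (c ` I) \<and> (\<forall>k. Ck_on m k W h)"
proof (cases "X = {}")
  case True
  then show ?thesis by (intro that) auto
next
  case False
  have "\<forall>y\<in>X. \<exists>\<rho>>0. \<forall>z\<in>Rn m.
      (\<forall>j<m. \<bar>Poly_Mapping.lookup z j - Poly_Mapping.lookup y j\<bar> \<le> \<rho>) \<longrightarrow> z \<in> N y"
    using box_subset_nhd[OF N(1) N(2)] XR by (metis subsetD)
  then obtain \<rho> where \<rho>: "\<And>y. y \<in> X \<Longrightarrow> 0 < \<rho> y"
    "\<And>y z. y \<in> X \<Longrightarrow> z \<in> Rn m \<Longrightarrow>
      (\<And>j. j < m \<Longrightarrow> \<bar>Poly_Mapping.lookup z j - Poly_Mapping.lookup y j\<bar> \<le> \<rho> y) \<Longrightarrow> z \<in> N y"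
    by metis
  have pos: "0 < \<rho> y / 2" if "y \<in> X" for y
    using \<rho>(1)[OF that] by simp
  obtain s :: "nat \<Rightarrow> fvec" where s: "range s \<subseteq> X"
    "\<And>x. x \<in> X \<Longrightarrow> \<exists>i. \<forall>j<m. \<bar>Poly_Mapping.lookup x j - Poly_Mapping.lookup (s i) j\<bar> < \<rho> (s i) / 2"
    using countable_box_cover[of X m "\<lambda>y. \<rho> y / 2", OF XR False pos] by blast
  have sX: "s i \<in> X" and \<rho>s: "0 < \<rho> (s i)" for i
    using s(1) \<rho>(1) by auto
  define \<psi> where "\<psi> i = bump m (s i) (\<rho> (s i))" for i
  define \<omega> where "\<omega> i z = \<psi> i z * (\<Prod>j<i. 1 - \<psi> j z)" for i z
  define h where "h z = (\<Sum>i\<in>{i. \<omega> i z \<noteq> 0}. \<omega> i z *\<^sub>R c (s i))" for z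
  have \<omega>_nonneg: "0 \<le> \<omega> i z" for i z
    unfolding \<omega>_def \<psi>_def by (intro mult_nonneg_nonneg prod_nonneg) (auto simp: bump_range)
  have Ck_\<omega>: "Ck_on m k U (\<omega> i)" for k U i
  proof -
    have "Ck_on m k U (\<lambda>z. \<psi> i z * (\<Prod>j<i. 1 + (-1) * \<psi> j z))"
      unfolding \<psi>_def by (intro Ck_on_mult Ck_on_prod Ck_on_add Ck_on_const Ck_on_bump)
    then show ?thesis by (simp add: \<omega>_def[abs_def])
  qed
  show ?thesis
  proof (rule that[of h])
    fix x assume x: "x \<in> X"
    obtain n where n: "\<forall>j<m. \<bar>Poly_Mapping.lookup x j - Poly_Mapping.lookup (s n) j\<bar> < \<rho> (s n) / 2"
      using s(2)[OF x] by blast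
    \<comment> \<open>\<open>A i\<close> contains the support of \<open>\<psi> i\<close>, and \<open>\<psi> n\<close> is \<open>1\<close> on the open box \<open>P\<close> around \<open>x\<close>.\<close>
    define A where "A i = {z::fvec. \<forall>j<m. \<bar>Poly_Mapping.lookup z j - Poly_Mapping.lookup (s i) j\<bar> \<le> \<rho> (s i)}" for i
    define J where "J = {i. i \<le> n \<and> x \<in> A i}"
    define P where "P = {z::fvec. \<forall>j<m. \<bar>Poly_Mapping.lookup z j - Poly_Mapping.lookup (s n) j\<bar> < \<rho> (s n) / 2}"
    define W where "W = Rn m \<inter> (P \<inter> (\<Inter>i\<in>{..n} - J. - A i))"
    have closed_A: "closed (A i)" for i
    proof -
      have "A i = (\<Inter>j\<in>{..<m}. {z. \<bar>Poly_Mapping.lookup z j - Poly_Mapping.lookup (s i) j\<bar> \<le> \<rho> (s i)})"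
        by (auto simp: A_def)
      also have "closed \<dots>"
        by (intro closed_INT ballI closed_Collect_le continuous_intros continuous_on_lookup)
      finally show ?thesis .
    qed
    have "open P"
    proof -
      have "P = (\<Inter>j\<in>{..<m}. {z. \<bar>Poly_Mapping.lookup z j - Poly_Mapping.lookup (s n) j\<bar> < \<rho> (s n) / 2})"
        by (auto simp: P_def)
      also have "open \<dots>"
        by (intro open_INT finite_lessThan ballI open_Collect_less continuous_intros continuous_on_lookup)
      finally show ?thesis .
    qed
    then have "open (P \<inter> (\<Inter>i\<in>{..n} - J. - A i))"
      using closed_A by (intro open_Int open_INT) auto
    then have W: "openin (top_of_set (Rn m)) W"
      unfolding W_def by (rule openin_open_Int)
    have "x \<in> W"
      using x XR n by (auto simp: W_def P_def J_def)
    \<comment> \<open>A closed box \<open>A i\<close> not containing \<open>x\<close> has been removed from \<open>W\<close>; the box \<open>P\<close> kills all later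
      weights.\<close>
    have vanish: "\<omega> i z = 0" if "z \<in> W" "i \<notin> J" for i z
    proof (cases "i \<le> n")
      case True
      then have "z \<notin> A i" using that by (auto simp: W_def)
      then have "\<psi> i z = 0"
        using bump_nonzero[OF \<rho>s[of i], of m "s i" z] by (auto simp: \<psi>_def A_def)
      then show ?thesis by (simp add: \<omega>_def)
    next
      case False
      have "\<psi> n z = 1"
        unfolding \<psi>_def using that(1) \<rho>s by (intro bump_eq_1) (auto simp: W_def P_def less_imp_le)
      then have "(\<Prod>j<i. 1 - \<psi> j z) = 0"
        using False by (intro prod_zero) auto
      then show ?thesis by (simp add: \<omega>_def)
    qed
    have finJ: "finite J" by (simp add: J_def)
    have h_eq: "h z = (\<Sum>i\<in>J. \<omega> i z *\<^sub>R c (s i))" if "z \<in> W" for z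
      unfolding h_def using vanish[OF that] finJ by (intro sum.mono_neutral_left) auto
    have sum_1: "(\<Sum>i\<in>J. \<omega> i z) = 1" if z: "z \<in> W" for z
    proof -
      have "\<psi> n z = 1"
        unfolding \<psi>_def using z \<rho>s by (intro bump_eq_1) (auto simp: W_def P_def less_imp_le)
      then have "(\<Prod>j<Suc n. 1 - \<psi> j z) = 0"
        by (intro prod_zero) auto
      then have "(\<Sum>i<Suc n. \<omega> i z) = 1"
        unfolding \<omega>_def by (subst sum_times_prod_complements) simp
      also have "(\<Sum>i<Suc n. \<omega> i z) = (\<Sum>i\<in>J. \<omega> i z)"
        using vanish[OF z] by (intro sum.mono_neutral_right) (auto simp: J_def)
      finally show ?thesis .
    qed
    show "\<exists>W I. openin (top_of_set (Rn m)) W \<and> x \<in> W \<and>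
      finite I \<and> I \<subseteq> {y\<in>X. x \<in> N y} \<and> h ` W \<subseteq> convex hull (c ` I) \<and> (\<forall>k. Ck_on m k W h)"
    proof (rule exI[of _ W], rule exI[of _ "s ` J"], intro conjI allI)
      show "s ` J \<subseteq> {y\<in>X. x \<in> N y}"
        using sX \<rho>(2) x XR by (auto simp: J_def A_def)
      show "h ` W \<subseteq> convex hull (c ` s ` J)"
      proof (rule image_subsetI)
        fix z assume z: "z \<in> W"
        show "h z \<in> convex hull (c ` s ` J)"
          unfolding h_eq[OF z]
          by (rule convex_sum[OF finJ convex_convex_hull sum_1[OF z] \<omega>_nonneg]) (simp add: hull_inc)
      qed
      show "Ck_on m k W h" for k
      proof (rule Ck_on_cong[OF W])
        show "Ck_on m k W (\<lambda>z. \<Sum>i\<in>J. \<omega> i z *\<^sub>R c (s i))"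
          by (intro Ck_on_sum Ck_on_scaleR Ck_\<omega> Ck_on_const)
      qed (simp add: h_eq)
    qed (use W \<open>x \<in> W\<close> finJ in auto)
  qed
qed

section \<open>Approximation through a triangulation\<close>

lemma locally_finite_complex_simplex:
  assumes "locally_finite_complex q L" "S \<in> L"
  shows "closed S" "convex S"
proof -
  have "is_simplex S"
    using assms by (simp add: locally_finite_complex_def)
  then obtain C where C: "finite C" "S = convex hull C"
    unfolding is_simplex_def by blast
  then show "closed S" "convex S"
    by (simp_all add: finite_imp_compact_convex_hull compact_imp_closed)
qed

text \<open>
  Only finitely many simplices come near \<open>p\<close>, and those that miss \<open>p\<close> are closed, so they stay
  away from some neighborhood of \<open>p\<close>.
\<close>

lemma simplices_near_point_contain_it:
  assumes L: "locally_finite_complex q L" and p: "p \<in> \<Union>L"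
  obtains V where "open V" "p \<in> V" "\<And>p' S. p' \<in> V \<Longrightarrow> S \<in> L \<Longrightarrow> p' \<in> S \<Longrightarrow> p \<in> S"
proof -
  have "\<forall>x\<in>\<Union>L. \<exists>W. openin (top_of_set (\<Union>L)) W \<and> x \<in> W \<and> finite {S\<in>L. S \<inter> W \<noteq> {}}"
    using L by (simp add: locally_finite_complex_def)
  then obtain W where W: "openin (top_of_set (\<Union>L)) W" "p \<in> W" "finite {S\<in>L. S \<inter> W \<noteq> {}}"
    using p by blast
  obtain V where V: "open V" "W = \<Union>L \<inter> V"
    using W(1) by (auto simp: openin_open)
  show ?thesis
  proof (rule that[of "V - \<Union>{S\<in>L. S \<inter> W \<noteq> {} \<and> p \<notin> S}"])
    have "finite {S\<in>L. S \<inter> W \<noteq> {} \<and> p \<notin> S}"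
      by (rule finite_subset[OF _ W(3)]) auto
    then have "closed (\<Union>{S\<in>L. S \<inter> W \<noteq> {} \<and> p \<notin> S})"
      using locally_finite_complex_simplex(1)[OF L] by (intro closed_Union) auto
    with V(1) show "open (V - \<Union>{S\<in>L. S \<inter> W \<noteq> {} \<and> p \<notin> S})"
      by blast
    show "p \<in> V - \<Union>{S\<in>L. S \<inter> W \<noteq> {} \<and> p \<notin> S}"
      using V W(2) by blast
    show "p \<in> S" if "p' \<in> V - \<Union>{S\<in>L. S \<inter> W \<noteq> {} \<and> p \<notin> S}" "S \<in> L" "p' \<in> S" for p' S
      using that V(2) by blast
  qed
qed

text \<open>
  The values \<open>s y\<close> are blended, each offered on a small neighborhood of \<open>y\<close>.  If \<open>x\<close> lies in that
  neighborhood, then every simplex containing \<open>s x\<close> contains \<open>s y\<close>.  Hence near \<open>x\<close> the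
  blended map \<open>h\<close> takes all its values in any simplex \<open>\<xi>\<close> that contains \<open>s x\<close>.  There \<open>\<Psi>\<close> agrees
  with a \<open>C\<^sup>r\<close> map on a relatively open set containing \<open>\<xi>\<close>, and \<open>\<Psi> \<circ> h\<close> is \<open>C\<^sup>r\<close> near \<open>x\<close> by the chain rule.
\<close>

lemma Cr_approximation:
  assumes L: "locally_finite_complex q L"
    and \<Psi>: "continuous_on (\<Union>L) \<Psi>" "\<And>\<xi>. \<xi> \<in> L \<Longrightarrow> Cr_map r q \<xi> n Y \<Psi>"
    and YR: "Y \<subseteq> Rn n"
    and X: "X \<subseteq> Rn m" "locally compact X"
    and s: "continuous_on X s" "s ` X \<subseteq> \<Union>L"
    and \<epsilon>: "continuous_on X \<epsilon>" "\<And>x. x \<in> X \<Longrightarrow> 0 < \<epsilon> x"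
  obtains g where "Cr_map r m X n Y g" "\<And>x. x \<in> X \<Longrightarrow> norm (g x - \<Psi> (s x)) < \<epsilon> x"
proof -
  define f where "f = \<Psi> \<circ> s"
  have f: "continuous_on X f"
    unfolding f_def using \<Psi>(1) s continuous_on_compose continuous_on_subset by blast
  \<comment> \<open>\<open>2 * \<rho>\<close>: one \<open>\<rho>\<close> for the step from \<open>s y\<close> to \<open>s x\<close>, one for the step from \<open>s x\<close> to \<open>h x\<close>.\<close>
  have "\<exists>\<rho>>0. \<forall>p\<in>\<Union>L. dist p (s y) < 2 * \<rho> \<longrightarrow> dist (\<Psi> p) (f y) < \<epsilon> y / 4" if y: "y \<in> X" for y
  proof -
    have "s y \<in> \<Union>L" "0 < \<epsilon> y / 4" using y s \<epsilon> by auto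
    then obtain d where "0 < d" "\<forall>p\<in>\<Union>L. dist p (s y) < d \<longrightarrow> dist (\<Psi> p) (\<Psi> (s y)) < \<epsilon> y / 4"
      using \<Psi>(1) unfolding continuous_on_iff by meson
    then show ?thesis by (intro exI[of _ "d / 2"]) (auto simp: f_def)
  qed
  then obtain \<rho> where \<rho>: "\<And>y. y \<in> X \<Longrightarrow> 0 < \<rho> y"
    "\<And>y p. y \<in> X \<Longrightarrow> p \<in> \<Union>L \<Longrightarrow> dist p (s y) < 2 * \<rho> y \<Longrightarrow> dist (\<Psi> p) (f y) < \<epsilon> y / 4"
    by metis
  have "\<exists>N. open N \<and> y \<in> N \<and> (\<forall>x\<in>X \<inter> N. (\<forall>\<xi>\<in>L. s x \<in> \<xi> \<longrightarrow> s y \<in> \<xi>) \<and>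
      dist (s x) (s y) < \<rho> y \<and> dist (f x) (f y) < \<epsilon> y / 4 \<and> \<epsilon> y / 2 < \<epsilon> x)" if y: "y \<in> X" for y
  proof -
    have sy: "s y \<in> \<Union>L" using s(2) y by (rule image_subset_iff[THEN iffD1, rule_format])
    obtain V where V: "open V" "s y \<in> V" "\<And>p' S. p' \<in> V \<Longrightarrow> S \<in> L \<Longrightarrow> p' \<in> S \<Longrightarrow> s y \<in> S"
      by (rule simplices_near_point_contain_it[OF L sy]) (rule that)
    have lim: "(s \<longlongrightarrow> s y) (at y within X)" "(f \<longlongrightarrow> f y) (at y within X)" "(\<epsilon> \<longlongrightarrow> \<epsilon> y) (at y within X)"
      using s(1) f \<epsilon>(1) y by (auto simp: continuous_on_def)
    have "\<forall>\<^sub>F x in at y within X. s x \<in> V \<and> dist (s x) (s y) < \<rho> y \<and> dist (f x) (f y) < \<epsilon> y / 4 \<and> \<epsilon> y / 2 < \<epsilon> x"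
      using \<rho>(1)[OF y] \<epsilon>(2)[OF y] V
      by (intro eventually_conj topological_tendstoD[OF lim(1)] tendstoD[OF lim(1)] tendstoD[OF lim(2)]
          order_tendstoD(1)[OF lim(3)]) auto
    then obtain N where N: "open N" "y \<in> N" "\<forall>x\<in>N. x \<noteq> y \<longrightarrow> x \<in> X \<longrightarrow>
        s x \<in> V \<and> dist (s x) (s y) < \<rho> y \<and> dist (f x) (f y) < \<epsilon> y / 4 \<and> \<epsilon> y / 2 < \<epsilon> x"
      unfolding eventually_at_topological by blast
    have "s x \<in> V \<and> dist (s x) (s y) < \<rho> y \<and> dist (f x) (f y) < \<epsilon> y / 4 \<and> \<epsilon> y / 2 < \<epsilon> x" if "x \<in> X \<inter> N" for x
      using N(3) that V(2) \<rho>(1)[OF y] \<epsilon>(2)[OF y] by (cases "x = y") auto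
    then show ?thesis
      using N(1,2) V(3) by blast
  qed
  then have "\<forall>y\<in>X. \<exists>N. open N \<and> y \<in> N \<and> (\<forall>x\<in>X \<inter> N. (\<forall>\<xi>\<in>L. s x \<in> \<xi> \<longrightarrow> s y \<in> \<xi>) \<and>
      dist (s x) (s y) < \<rho> y \<and> dist (f x) (f y) < \<epsilon> y / 4 \<and> \<epsilon> y / 2 < \<epsilon> x)" ..
  from bchoice[OF this] obtain N where N_all: "\<forall>y\<in>X. open (N y) \<and> y \<in> N y \<and>
      (\<forall>x\<in>X \<inter> N y. (\<forall>\<xi>\<in>L. s x \<in> \<xi> \<longrightarrow> s y \<in> \<xi>) \<and>
      dist (s x) (s y) < \<rho> y \<and> dist (f x) (f y) < \<epsilon> y / 4 \<and> \<epsilon> y / 2 < \<epsilon> x)" ..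
  have N: "open (N y)" "y \<in> N y" if "y \<in> X" for y
    using N_all that by simp_all
  have near_simplex: "s y \<in> \<xi>" if "y \<in> X" "x \<in> X" "x \<in> N y" "\<xi> \<in> L" "s x \<in> \<xi>" for y x \<xi>
    using N_all that by simp
  have near_dist: "dist (s x) (s y) < \<rho> y \<and> dist (f x) (f y) < \<epsilon> y / 4 \<and> \<epsilon> y / 2 < \<epsilon> x"
    if "y \<in> X" "x \<in> X" "x \<in> N y" for y x
    using N_all that by simp
  obtain h where h: "\<And>x. x \<in> X \<Longrightarrow> \<exists>W I. openin (top_of_set (Rn m)) W \<and> x \<in> W \<and>
      finite I \<and> I \<subseteq> {y\<in>X. x \<in> N y} \<and> h ` W \<subseteq> convex hull (s ` I) \<and> (\<forall>k. Ck_on m k W h)"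
    using smooth_blending[OF X(1) N, of s] by blast
  have into_simplex: "\<exists>W. openin (top_of_set (Rn m)) W \<and> x \<in> W \<and> h ` W \<subseteq> \<xi> \<and> (\<forall>k. Ck_on m k W h)"
    if x: "x \<in> X" and \<xi>: "\<xi> \<in> L" "s x \<in> \<xi>" for x \<xi>
  proof -
    obtain W I where W: "openin (top_of_set (Rn m)) W" "x \<in> W" "I \<subseteq> {y\<in>X. x \<in> N y}"
      "h ` W \<subseteq> convex hull (s ` I)" "\<forall>k. Ck_on m k W h"
      using h[OF x] by blast
    have "s ` I \<subseteq> \<xi>"
      using W(3) near_simplex[OF _ x _ \<xi>] by blast
    then have "convex hull (s ` I) \<subseteq> \<xi>"
      using locally_finite_complex_simplex(2)[OF L \<xi>(1)] by (simp add: hull_minimal)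
    with W show ?thesis by blast
  qed
  have close: "norm (\<Psi> (h x) - f x) < \<epsilon> x" if x: "x \<in> X" for x
  proof -
    obtain W I where W: "x \<in> W" "finite I" "I \<subseteq> {y\<in>X. x \<in> N y}" "h ` W \<subseteq> convex hull (s ` I)"
      using h[OF x] by blast
    have "h x \<in> convex hull (s ` I)" using W by blast
    then have "I \<noteq> {}" by auto
    \<comment> \<open>All blended values lie within the largest of the radii \<open>\<rho> y'\<close> of \<open>s x\<close>, so comparing with the
      point \<open>y\<close> that has this radius spares a radius depending continuously on \<open>x\<close>.\<close>
    then have "Max (\<rho> ` I) \<in> \<rho> ` I" using W(2) by (intro Max_in) auto
    then obtain y where y: "y \<in> I" "\<rho> y = Max (\<rho> ` I)" by auto
    have max: "\<rho> y' \<le> \<rho> y" if "y' \<in> I" for y'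
      unfolding y(2) using W(2) that by (intro Max_ge) auto
    have yX: "y \<in> X" "x \<in> N y" using y W(3) by auto
    note near_y = near_dist[OF yX(1) x yX(2)]
    have "s ` I \<subseteq> ball (s x) (\<rho> y)"
    proof (rule image_subsetI)
      fix y' assume "y' \<in> I"
      then have "dist (s x) (s y') < \<rho> y'" "\<rho> y' \<le> \<rho> y"
        using near_dist[of y' x] x W(3) max by auto
      then show "s y' \<in> ball (s x) (\<rho> y)" by simp
    qed
    then have "convex hull (s ` I) \<subseteq> ball (s x) (\<rho> y)"
      by (simp add: hull_minimal)
    then have "dist (s x) (h x) < \<rho> y"
      using \<open>h x \<in> convex hull (s ` I)\<close> by auto
    then have "dist (h x) (s y) < 2 * \<rho> y"
      using near_y dist_triangle[of "h x" "s y" "s x"] by (simp add: dist_commute)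
    moreover have "h x \<in> \<Union>L"
      using into_simplex[OF x] s(2) x by blast
    ultimately have "dist (\<Psi> (h x)) (f y) < \<epsilon> y / 4"
      using \<rho>(2) yX by blast
    then have "dist (\<Psi> (h x)) (f x) < \<epsilon> y / 2"
      using near_y dist_triangle[of "\<Psi> (h x)" "f x" "f y"] by (simp add: dist_commute)
    then show ?thesis using near_y by (simp add: dist_norm)
  qed
  obtain U0 where U0: "open U0" "closedin (top_of_set U0) X"
    using locally_compact_closedin_open[OF X(2)] by blast
  have "\<exists>W. openin (top_of_set (Rn m)) W \<and> x \<in> W \<and> W \<subseteq> U0 \<and> (\<Psi> \<circ> h) ` W \<subseteq> Y \<and> Cr_on m r W (\<Psi> \<circ> h)"
    if x: "x \<in> X" for x
  proof -
    obtain \<xi> where \<xi>: "\<xi> \<in> L" "s x \<in> \<xi>" using s(2) x by blast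
    obtain W where W: "openin (top_of_set (Rn m)) W" "x \<in> W" "h ` W \<subseteq> \<xi>" "\<forall>k. Ck_on m k W h"
      using into_simplex[OF x \<xi>] by blast
    obtain V G where G: "openin (top_of_set (Rn q)) V" "closedin (top_of_set V) \<xi>" "Cr_on q r V G"
      "\<forall>p\<in>\<xi>. \<Psi> p = G p" and \<Psi>\<xi>: "\<Psi> ` \<xi> \<subseteq> Y"
      using \<Psi>(2)[OF \<xi>(1)] unfolding Cr_map_def by blast
    define W' where "W' = W \<inter> U0"
    have W': "openin (top_of_set (Rn m)) W'" "x \<in> W'" "h ` W' \<subseteq> \<xi>"
      using W U0 closedin_imp_subset[OF U0(2)] x by (auto simp: W'_def intro: openin_Int_open)
    have "\<xi> \<subseteq> V" using closedin_imp_subset[OF G(2)] .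
    have "Cr_on m r W' (\<Psi> \<circ> h)"
      unfolding Cr_on_def
    proof (intro allI impI)
      fix k assume k: "enat k \<le> r"
      have "Ck_on m k W' (\<lambda>z. G (h z))"
      proof (rule Ck_on_compose[where h=h and G=G, OF W'(1) G(1)])
        show "h ` W' \<subseteq> V" using W'(3) \<open>\<xi> \<subseteq> V\<close> by blast
        show "Ck_on m k W' h" using W(4) Ck_on_subset[of m k W h W'] by (simp add: W'_def)
        show "Ck_on q k V G" using G(3) k by (simp add: Cr_on_def)
      qed
      then show "Ck_on m k W' (\<Psi> \<circ> h)"
        by (rule Ck_on_cong[OF W'(1), rotated]) (use G(4) W'(3) in auto)
    qed
    then show ?thesis
      using W'(1,2) image_mono[OF W'(3), of \<Psi>] \<Psi>\<xi>
      by (intro exI[of _ W'] conjI) (auto simp: W'_def image_comp)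
  qed
  then have "\<forall>x\<in>X. \<exists>W. openin (top_of_set (Rn m)) W \<and> x \<in> W \<and> W \<subseteq> U0 \<and> (\<Psi> \<circ> h) ` W \<subseteq> Y \<and>
      Cr_on m r W (\<Psi> \<circ> h)" ..
  from bchoice[OF this] obtain W where W_all: "\<forall>x\<in>X. openin (top_of_set (Rn m)) (W x) \<and> x \<in> W x \<and>
      W x \<subseteq> U0 \<and> (\<Psi> \<circ> h) ` W x \<subseteq> Y \<and> Cr_on m r (W x) (\<Psi> \<circ> h)" ..
  have W: "openin (top_of_set (Rn m)) (W x)" "x \<in> W x" "W x \<subseteq> U0" "(\<Psi> \<circ> h) ` W x \<subseteq> Y"
    "Cr_on m r (W x) (\<Psi> \<circ> h)" if "x \<in> X" for x
    using W_all that by blast+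
  define U where "U = (\<Union>x\<in>X. W x)"
  have "openin (top_of_set (Rn m)) U"
    unfolding U_def using W(1) by blast
  moreover have "closedin (top_of_set U) X"
    by (rule closedin_subset_trans[OF U0(2)]) (use W(2,3) in \<open>auto simp: U_def\<close>)
  moreover have "(\<Psi> \<circ> h) ` U \<subseteq> Y"
    using W(4) unfolding U_def by blast
  moreover have "Cr_on m r U (\<Psi> \<circ> h)"
    unfolding Cr_on_def
  proof (intro allI impI Ck_on_locally)
    fix k z assume "enat k \<le> r" "z \<in> U"
    then obtain x where "x \<in> X" "z \<in> W x" "Ck_on m k (W x) (\<Psi> \<circ> h)"
      using W(5) unfolding U_def Cr_on_def by blast
    then show "\<exists>W. openin (top_of_set (Rn m)) W \<and> z \<in> W \<and> W \<subseteq> U \<and> Ck_on m k W (\<Psi> \<circ> h)"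
      using W(1) unfolding U_def by blast
  qed
  moreover have "X \<subseteq> U" using W(2) by (auto simp: U_def)
  ultimately have "Cr_map r m X n Y (\<Psi> \<circ> h)"
    unfolding Cr_map_def using YR by (intro conjI exI[of _ U] exI[of _ "\<Psi> \<circ> h"]) blast+
  with close show ?thesis
    by (intro that) (auto simp: f_def)
qed

lemma Cr_map_imp_continuous_on:
  assumes "Cr_map r m X n Y g"
  shows "continuous_on X g"
proof -
  obtain U and G :: "fvec \<Rightarrow> fvec" where G: "closedin (top_of_set U) X" "Cr_on m r U G" "\<forall>x\<in>X. g x = G x"
    using assms unfolding Cr_map_def by blast
  have "enat 0 \<le> r" by (simp flip: zero_enat_def)
  then have "continuous_on U G"
    using G(2) Ck_on_imp_continuous_on unfolding Cr_on_def by blast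
  then have "continuous_on X G"
    using closedin_imp_subset[OF G(1)] continuous_on_subset by blast
  then show ?thesis
    using G(3) continuous_on_cong[of X X g G] by simp
qed

lemma Cr_map_cong: "Cr_map r m X n Y g \<Longrightarrow> (\<And>x. x \<in> X \<Longrightarrow> g x = g' x) \<Longrightarrow> Cr_map r m X n Y g'"
  unfolding Cr_map_def by (metis (no_types, lifting) image_cong)

theorem theorem1p6:
  fixes r :: enat and n :: nat and Y :: "fvec set"
  assumes "1 \<le> r"
    and "Y \<subseteq> Rn n" and "Y \<noteq> {}"
    and "weakly_Cr_triangulable r n Y"
  shows "Cr_approximation_target_space r n Y"
proof -
  obtain q L \<Psi> \<Phi> where L: "locally_finite_complex q L" and hom: "homeomorphism (\<Union>L) Y \<Psi> \<Phi>"
    and Cr: "\<And>\<xi>. \<xi> \<in> L \<Longrightarrow> Cr_map r q \<xi> n Y \<Psi>"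
    using assms(4) unfolding weakly_Cr_triangulable_def by blast
  have "triangulable Y"
    using assms(3) L hom homeomorphic_sym unfolding triangulable_def homeomorphic_def by blast
  moreover have "strong_C0_topology X Y closure_of Cr_maps r m X n Y = topspace (strong_C0_topology X Y)"
    if X: "X \<subseteq> Rn m" "locally compact X" for m X
  proof (rule antisym[OF closure_of_subset_topspace], rule subsetI)
    fix f assume "f \<in> topspace (strong_C0_topology X Y)"
    then have f: "f \<in> C0_maps X Y" by (simp add: topspace_strong_C0_topology)
    then have fc: "continuous_on X f" "f ` X \<subseteq> Y" by (auto simp: C0_maps_def)
    have s: "continuous_on X (\<Phi> \<circ> f)" "(\<Phi> \<circ> f) ` X \<subseteq> \<Union>L"
    proof -
      show "continuous_on X (\<Phi> \<circ> f)"
        by (rule continuous_on_compose[OF fc(1) continuous_on_subset[OF homeomorphism_cont2[OF hom] fc(2)]])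
      show "(\<Phi> \<circ> f) ` X \<subseteq> \<Union>L"
        unfolding image_comp[symmetric] homeomorphism_image2[OF hom, symmetric] by (rule image_mono[OF fc(2)])
    qed
    have \<Psi>s: "\<Psi> ((\<Phi> \<circ> f) x) = f x" if "x \<in> X" for x
    proof -
      have "f x \<in> Y" using fc(2) that by (rule image_subset_iff[THEN iffD1, rule_format])
      then show ?thesis by (simp add: homeomorphism_apply2[OF hom])
    qed
    \<comment> \<open>Approximating in the \<open>l\<^sup>1\<close> norm is enough, as it dominates the Euclidean norm.\<close>
    have "\<exists>g. g \<in> Cr_maps r m X n Y \<and> g \<in> T" if T: "f \<in> T" "openin (strong_C0_topology X Y) T" for T
    proof -
      obtain \<epsilon> where \<epsilon>: "continuous_on X \<epsilon>" "\<And>x. x \<in> X \<Longrightarrow> 0 < \<epsilon> x" "strong_nhd X Y f \<epsilon> \<subseteq> T"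
        using T unfolding openin_strong_C0_topology strong_open_def by blast
      obtain g where g: "Cr_map r m X n Y g" "\<And>x. x \<in> X \<Longrightarrow> norm (g x - \<Psi> ((\<Phi> \<circ> f) x)) < \<epsilon> x"
        using Cr_approximation[OF L homeomorphism_cont1[OF hom] Cr assms(2) X s \<epsilon>(1,2)] by blast
      define g' where "g' = restrict g X"
      have g': "Cr_map r m X n Y g'"
        using g(1) by (rule Cr_map_cong) (simp add: g'_def)
      have C0: "g' \<in> C0_maps X Y"
        using Cr_map_imp_continuous_on[OF g'] g' by (auto simp: C0_maps_def Cr_map_def g'_def)
      have "enorm (g' x - f x) < \<epsilon> x" if "x \<in> X" for x
      proof -
        have "enorm (g' x - f x) \<le> norm (g' x - f x)"
          unfolding enorm_def norm_fvec by (rule L2_set_le_sum_abs)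
        also have "\<dots> < \<epsilon> x"
          using g(2)[OF that] \<Psi>s[OF that] that by (simp add: g'_def)
        finally show ?thesis .
      qed
      then have "g' \<in> T"
        using \<epsilon>(3) C0 by (auto simp: strong_nhd_def)
      with C0 g' show ?thesis
        by (auto simp: Cr_maps_def)
    qed
    then show "f \<in> strong_C0_topology X Y closure_of Cr_maps r m X n Y"
      using f by (auto simp: in_closure_of topspace_strong_C0_topology)
  qed
  ultimately show ?thesis
    unfolding Cr_approximation_target_space_def by blast
qed

end
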